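(* Let $P(\lambda)=\sum_{j=0}^m A_j\lambda^j$ be an $n\times n$ matrix polynomial with $A_j\in\mathbb{C}^{n\times n}$, $m\ge 1$ and $\det A_m\neq 0$, and let $w_0>0$, $w_1,\dots,w_m\ge 0$ be given weights. Suppose that $\lambda_0$ is a multiple eigenvalue of $P(\lambda)$ and let $p_0$ be the dimension of the maximum Jordan blocks of $P(\lambda)$ corresponding to $\lambda_0$. Then, as $\varepsilon\to 0$ ($\varepsilon>0$), the Hausdorff distance between the connected component of the pseudospectrum $\sigma_\varepsilon(P)$ that contains $\lambda_0$ and the disc $$\left\{\mu\in\mathbb{C}:\ |\mu-\lambda_0|\le\left(\hat k(P,\lambda_0)\,\varepsilon\right)^{1/p_0}\right\}$$ is $o(\varepsilon^{1/p_0})$.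
   Context: $\|\cdot\|$ is the spectral matrix norm (subordinate to the Euclidean norm). Eigenvalues: $\lambda_0\in\mathbb{C}$ is an eigenvalue of $P$ if $\det P(\lambda_0)=0$; its algebraic multiplicity is its multiplicity as a zero of the scalar polynomial $\det P(\lambda)$; $\lambda_0$ is multiple if its algebraic multiplicity is at least $2$. $\sigma(P)$ is the set of eigenvalues. Pseudospectrum: with $w(\lambda)=w_m\lambda^m+\cdots+w_1\lambda+w_0$, $$\sigma_\varepsilon(P)=\{\mu\in\mathbb{C}: \det Q(\mu)=0 \text{ for some } Q(\lambda)=\sum_{j=0}^m (A_j+\Delta_j)\lambda^j \text{ with } \|\Delta_j\|\le\varepsilon w_j,\ j=0,\dots,m\}=\{\mu\in\mathbb{C}: s_{\min}(P(\mu))\le\varepsilon\,w(|\mu|)\},$$ where $s_{\min}$ denotes the minimum singular value. Jordan chains: a Jordan chain of length $s$ of $P$ for $\lambda_0$ is a sequence $x_1,\dots,x_s\in\mathbb{C}^n$ with $x_1\ne 0$ and $\sum_{j=1}^{\xi}\frac{1}{(j-1)!}P^{(j-1)}(\lambda_0)x_{\xi-j+1}=0$ for $\xi=1,\dots,s$. Each eigenvalue of geometric multiplicity $k=\dim\ker P(\lambda_0)$ has $k$ maximal Jordan chains associated to $k$ linearly independent eigenvectors, with total length equal to its algebraic multiplicity. Jordan triple: let $X\in\mathbb{C}^{n\times nm}$ be the matrix whose columns are the vectors of such maximal Jordan chains for all eigenvalues of $P$ (chain after chain, each chain in the order $x_1,\dots,x_s$), and let $J\in\mathbb{C}^{nm\times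 nm}$ be the associated Jordan matrix (a direct sum of upper-triangular Jordan blocks, one for each chain, with the corresponding eigenvalue on the diagonal and ones on the superdiagonal). Then the $nm\times nm$ matrix $\begin{bmatrix}X\\ XJ\\ \vdots\\ XJ^{m-1}\end{bmatrix}$ is invertible, and one sets $Y=\begin{bmatrix}X\\ XJ\\ \vdots\\ XJ^{m-1}\end{bmatrix}^{-1}\begin{bmatrix}0\\ \vdots\\ 0\\ A_m^{-1}\end{bmatrix}\in\mathbb{C}^{nm\times n}$; $(X,J,Y)$ is called a Jordan triple of $P$, and satisfies $P(\lambda)^{-1}=X(\lambda I-J)^{-1}Y$ for $\lambda\notin\sigma(P)$. The Jordan blocks of $P$ are the blocks of $J$. Condition number of a multiple eigenvalue: let $p_0$ be the maximum length of Jordan chains of $\lambda_0$. Order the Jordan triple so that $J=J_1\oplus\cdots\oplus J_{\kappa_0}\oplus\tilde J$, where $J_1,\dots,J_{\kappa_0}$ are all the $p_0\times p_0$ Jordan blocks of $\lambda_0$, and $\tilde J$ contains all the Jordan blocks of $\lambda_0$ of order less than $p_0$ and all Jordan blocks of the other eigenvalues. For $k=1,\dots,\kappa_0$ let $x_{k,1}$ be the first column of $X$ in the group of $p_0$ columns corresponding to $J_k$ (i.e. column $(k-1)p_0+1$), and let $y_{k,1}^*$ be the last row of $Y$ in the group of $p_0$ rows corresponding to $J_k$ (i.e. row $kp_0$). Put $\hat X=[x_{1,1}\ \cdots\ x_{\kappa_0,1}]\in\mathbb{C}^{n\times\kappa_0}$ and let $\hat Y\in\mathbb{C}^{\kappa_0\times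 n}$ be the matrix with rows $y_{1,1}^*,\dots,y_{\kappa_0,1}^*$. Then $\hat k(P,\lambda_0)=w(|\lambda_0|)\,\|\hat X\hat Y\|$. Hausdorff distance between $\mathcal S,\mathcal T\subset\mathbb{C}$: $\max\{\sup_{s\in\mathcal S}\inf_{t\in\mathcal T}|s-t|,\ \sup_{t\in\mathcal T}\inf_{s\in\mathcal S}|s-t|\}$. *)

theory Defs
  imports
    "HOL-Analysis.Elementary_Metric_Spaces"
    "HOL-Analysis.Connected"
    "HOL-Library.Landau_Symbols"
    "Jordan_Normal_Form.Matrix_Kernel"
    "Jordan_Normal_Form.Jordan_Normal_Form"
begin

section \<open>Spectral norm\<close>

definition euclid_norm :: "complex vec \<Rightarrow> real" where
  "euclid_norm v = sqrt (\<Sum>i<dim_vec v. (cmod (v $ i))\<^sup>2)"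

definition spectral_norm :: "complex mat \<Rightarrow> real" where
  "spectral_norm M =
    (SUP x\<in>{x \<in> carrier_vec (dim_col M). euclid_norm x \<le> 1}. euclid_norm (M *\<^sub>v x))"


section \<open>Matrix polynomials and their eigenvalues\<close>

text \<open>The \<open>n \<times> n\<close> matrix polynomial with coefficients \<open>A 0, \<dots>, A m\<close> is represented as a matrix
  with polynomial entries; values of \<open>A\<close> beyond \<open>m\<close> are ignored.\<close>

definition mat_poly :: "nat \<Rightarrow> nat \<Rightarrow> (nat \<Rightarrow> complex mat) \<Rightarrow> complex poly mat" where
  "mat_poly n m A = mat n n (\<lambda>(i, j). \<Sum>k\<le>m. monom (A k $$ (i, j)) k)"

definition mat_poly_deriv ::
    "nat \<Rightarrow> nat \<Rightarrow> (nat \<Rightarrow> complex mat) \<Rightarrow> nat \<Rightarrow> complex \<Rightarrow> complex mat" where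
  "mat_poly_deriv n m A k z = map_mat (\<lambda>p. poly ((pderiv ^^ k) p) z) (mat_poly n m A)"

definition mat_poly_eval :: "nat \<Rightarrow> nat \<Rightarrow> (nat \<Rightarrow> complex mat) \<Rightarrow> complex \<Rightarrow> complex mat" where
  "mat_poly_eval n m A z = map_mat (\<lambda>p. poly p z) (mat_poly n m A)"

lemma mat_poly_eval_index:
  assumes "i < n" "j < n"
  shows "mat_poly_eval n m A z $$ (i, j) = (\<Sum>k\<le>m. A k $$ (i, j) * z ^ k)"
  using assms by (simp add: mat_poly_eval_def mat_poly_def poly_sum poly_monom)

lemma mat_poly_deriv_0: "mat_poly_deriv n m A 0 = mat_poly_eval n m A"
  by (simp add: mat_poly_deriv_def mat_poly_eval_def fun_eq_iff)

definition is_eigenvalue :: "nat \<Rightarrow> nat \<Rightarrow> (nat \<Rightarrow> complex mat) \<Rightarrow> complex \<Rightarrow> bool" where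
  "is_eigenvalue n m A l \<longleftrightarrow> Determinant.det (mat_poly_eval n m A l) = 0"

definition alg_mult :: "nat \<Rightarrow> nat \<Rightarrow> (nat \<Rightarrow> complex mat) \<Rightarrow> complex \<Rightarrow> nat" where
  "alg_mult n m A l = order l (Determinant.det (mat_poly n m A))"

definition multiple_eigenvalue :: "nat \<Rightarrow> nat \<Rightarrow> (nat \<Rightarrow> complex mat) \<Rightarrow> complex \<Rightarrow> bool" where
  "multiple_eigenvalue n m A l \<longleftrightarrow> is_eigenvalue n m A l \<and> 2 \<le> alg_mult n m A l"


section \<open>Pseudospectrum\<close>

definition weight :: "nat \<Rightarrow> (nat \<Rightarrow> real) \<Rightarrow> real \<Rightarrow> real" where
  "weight m w x = (\<Sum>j\<le>m. w j * x ^ j)"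

definition pseudospectrum ::
    "nat \<Rightarrow> nat \<Rightarrow> (nat \<Rightarrow> complex mat) \<Rightarrow> (nat \<Rightarrow> real) \<Rightarrow> real \<Rightarrow> complex set" where
  "pseudospectrum n m A w e =
    {z. \<exists>D :: nat \<Rightarrow> complex mat.
          (\<forall>j\<le>m. D j \<in> carrier_mat n n \<and> spectral_norm (D j) \<le> e * w j) \<and>
          Determinant.det (mat_poly_eval n m (\<lambda>j. A j + D j) z) = 0}"


section \<open>Jordan chains and Jordan triples\<close>

text \<open>The chain \<open>x\<^sub>1, \<dots>, x\<^sub>s\<close> is stored as a list, so that \<open>x\<^sub>k = xs ! (k - 1)\<close>.\<close>

definition jordan_chain ::
    "nat \<Rightarrow> nat \<Rightarrow> (nat \<Rightarrow> complex mat) \<Rightarrow> complex \<Rightarrow> complex vec list \<Rightarrow> bool" where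
  "jordan_chain n m A l xs \<longleftrightarrow>
    xs \<noteq> [] \<and> set xs \<subseteq> carrier_vec n \<and> xs ! 0 \<noteq> 0\<^sub>v n \<and>
    (\<forall>k\<in>{1..length xs}.
      finsum_vec TYPE(complex) n
        (\<lambda>j. (1 / fact (j - 1)) \<cdot>\<^sub>v (mat_poly_deriv n m A (j - 1) l *\<^sub>v (xs ! (k - j)))) {1..k}
      = 0\<^sub>v n)"

definition maximal_jordan_chain ::
    "nat \<Rightarrow> nat \<Rightarrow> (nat \<Rightarrow> complex mat) \<Rightarrow> complex \<Rightarrow> complex vec list \<Rightarrow> bool" where
  "maximal_jordan_chain n m A l xs \<longleftrightarrow>
    jordan_chain n m A l xs \<and> \<not> (\<exists>x. jordan_chain n m A l (xs @ [x]))"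

text \<open>A complete system of maximal Jordan chains for all eigenvalues, as a list of pairs of an
  eigenvalue and a chain for it.\<close>

definition jordan_chain_system ::
    "nat \<Rightarrow> nat \<Rightarrow> (nat \<Rightarrow> complex mat) \<Rightarrow> (complex \<times> complex vec list) list \<Rightarrow> bool" where
  "jordan_chain_system n m A cs \<longleftrightarrow>
    (\<forall>(l, xs) \<in> set cs. is_eigenvalue n m A l \<and> maximal_jordan_chain n m A l xs) \<and>
    (\<forall>l. is_eigenvalue n m A l \<longrightarrow>
      (let chains = map snd (filter (\<lambda>c. fst c = l) cs); eigvecs = map hd chains in
        length chains = kernel_dim (mat_poly_eval n m A l) \<and>
        distinct eigvecs \<and>
        \<not> LinearCombinations.module.lin_dep class_ring (module_vec TYPE(complex) n)
            (set eigvecs) \<and>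
        sum_list (map length chains) = alg_mult n m A l))"

definition jordan_blocks :: "(complex \<times> complex vec list) list \<Rightarrow> (nat \<times> complex) list" where
  "jordan_blocks cs = map (\<lambda>(l, xs). (length xs, l)) cs"

text \<open>The \<open>n m \<times> n m\<close> matrix with the blocks \<open>X, X J, \<dots>, X J\<^bsup>m-1\<^esup>\<close> stacked on top of each other.\<close>

definition stacked_mat :: "nat \<Rightarrow> nat \<Rightarrow> complex mat \<Rightarrow> complex mat \<Rightarrow> complex mat" where
  "stacked_mat n m X J = mat (n * m) (n * m) (\<lambda>(i, j). (X * J ^\<^sub>m (i div n)) $$ (i mod n, j))"

text \<open>\<open>the (mat_inverse M)\<close> is the inverse of an invertible matrix \<open>M\<close>; that \<open>A m\<close> and the stacked
  matrix are invertible is not built into the definition.\<close>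

definition jordan_triple ::
    "nat \<Rightarrow> nat \<Rightarrow> (nat \<Rightarrow> complex mat) \<Rightarrow> (complex \<times> complex vec list) list \<Rightarrow>
      complex mat \<Rightarrow> complex mat \<Rightarrow> complex mat \<Rightarrow> bool" where
  "jordan_triple n m A cs X J Y \<longleftrightarrow>
    jordan_chain_system n m A cs \<and>
    X = mat_of_cols n (concat (map snd cs)) \<and>
    J = jordan_matrix (jordan_blocks cs) \<and>
    Y = the (mat_inverse (stacked_mat n m X J)) *
        (0\<^sub>m (n * (m - 1)) n @\<^sub>r the (mat_inverse (A m)))"


section \<open>Condition number of a multiple eigenvalue\<close>

definition max_block_size :: "complex \<Rightarrow> (complex \<times> complex vec list) list \<Rightarrow> nat" where
  "max_block_size l cs = Max {s. (s, l) \<in> set (jordan_blocks cs)}"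

definition num_max_blocks :: "complex \<Rightarrow> (complex \<times> complex vec list) list \<Rightarrow> nat" where
  "num_max_blocks l cs = length (filter (\<lambda>b. b = (max_block_size l cs, l)) (jordan_blocks cs))"

text \<open>The Jordan blocks of \<open>l\<close> of maximal size come first.\<close>

definition max_blocks_first :: "complex \<Rightarrow> (complex \<times> complex vec list) list \<Rightarrow> bool" where
  "max_blocks_first l cs \<longleftrightarrow>
    (\<forall>k<num_max_blocks l cs. jordan_blocks cs ! k = (max_block_size l cs, l))"

text \<open>Columns, rows and blocks are counted from \<open>0\<close> here: block \<open>k < num_max_blocks l cs\<close> occupies
  the positions \<open>k p, \<dots>, k p + p - 1\<close>.\<close>

definition hat_X :: "nat \<Rightarrow> complex \<Rightarrow> (complex \<times> complex vec list) list \<Rightarrow> complex mat \<Rightarrow> complex mat"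
  where "hat_X n l cs X =
    (let p = max_block_size l cs in
      mat n (num_max_blocks l cs) (\<lambda>(i, k). X $$ (i, k * p)))"

definition hat_Y :: "nat \<Rightarrow> complex \<Rightarrow> (complex \<times> complex vec list) list \<Rightarrow> complex mat \<Rightarrow> complex mat"
  where "hat_Y n l cs Y =
    (let p = max_block_size l cs in
      mat (num_max_blocks l cs) n (\<lambda>(k, j). Y $$ (k * p + p - 1, j)))"

text \<open>Meaningful if \<open>(X, J, Y)\<close> is a Jordan triple built from \<open>cs\<close> and \<open>max_blocks_first l cs\<close>.\<close>

definition hat_k ::
    "nat \<Rightarrow> nat \<Rightarrow> (nat \<Rightarrow> real) \<Rightarrow> complex \<Rightarrow> (complex \<times> complex vec list) list \<Rightarrow>
      complex mat \<Rightarrow> complex mat \<Rightarrow> real" where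
  "hat_k n m w l cs X Y = weight m w (cmod l) * spectral_norm (hat_X n l cs X * hat_Y n l cs Y)"


section \<open>Hausdorff distance\<close>

text \<open>Real-valued, hence meaningful only for nonempty bounded sets. The component of the
  pseudospectrum to which it is applied contains the eigenvalue and, as the leading coefficient
  is nonsingular, is bounded for all sufficiently small \<open>\<epsilon>\<close>.\<close>

definition hausdorff_distance :: "complex set \<Rightarrow> complex set \<Rightarrow> real" where
  "hausdorff_distance S T = max (SUP s\<in>S. infdist s T) (SUP t\<in>T. infdist t S)"

end

theory Submission
  imports "HOL-Analysis.L2_Norm" "Jordan_Normal_Form.DL_Rank" Defs
begin

text \<open>
  A perturbation of size \<open>\<epsilon>\<close> can make \<open>P(z)\<close> singular exactly if
  \<open>1 \<le> \<epsilon> w(|z|) \<parallel>P(z)\<inverse>\<parallel>\<close>, up to the boundary case of equality. The strict versions of the two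
  directions are \<open>not_in_pseudospectrum\<close> (a Neumann-type estimate) and \<open>in_pseudospectrum\<close> (a rank-one
  perturbation, distributed over the coefficients in proportion to the weights). So near an
  eigenvalue \<open>l\<close> the pseudospectrum is governed by the growth of \<open>P(z)\<inverse>\<close>.

  This growth is read off from the representation \<open>P(z)\<inverse> = X (zI - J)\<inverse> Y\<close>
  (\<open>mat_poly_eval_mult_mat_poly_inverse\<close>). The entries of \<open>(zI - J)\<inverse>\<close> are the powers
  \<open>(z - \<lambda>)\<^bsup>-d-1\<^esup>\<close> on the \<open>d\<close>-th superdiagonal of a block with eigenvalue \<open>\<lambda>\<close>. The most singular
  ones at \<open>l\<close> sit in the upper right corners of the blocks of maximal size \<open>p\<close>, hence
  \<open>(z - l)\<^bsup>p\<^esup> P(z)\<inverse>\<close> tends to the product of the first columns in \<open>X\<close> and the last rows in \<open>Y\<close> that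
  belong to these blocks (\<open>tendsto_scaled_mat_poly_inverse\<close>). Consequently
  \<open>\<phi>(z) = |z - l|\<^bsup>p\<^esup> w(|z|) \<parallel>P(z)\<inverse>\<parallel>\<close> tends to the condition number \<open>k\<close>.

  Near \<open>l\<close> the pseudospectrum is therefore \<open>{z. |z - l|\<^bsup>p\<^esup> \<le> \<epsilon> \<phi>(z)}\<close>, where \<open>\<phi>(z)\<close> lies between
  \<open>k - \<delta>\<close> and \<open>k + \<delta>\<close>. It contains the disc of radius \<open>((k - \<delta>) \<epsilon>)\<^bsup>1/p\<^esup>\<close>, and a whole annulus outside
  the disc of radius \<open>((k + \<delta>) \<epsilon>)\<^bsup>1/p\<^esup>\<close> is disjoint from it, so the component of \<open>l\<close> is squeezed between
  the two discs (\<open>hausdorff_distance_component_smallo\<close>). If \<open>k \<le> \<delta>\<close>, the inner disc is just \<open>{l}\<close>.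

  It remains to justify the representation of the inverse. The Jordan chain equations say
  \<open>\<Sum>\<^sub>k A\<^sub>k X J\<^bsup>k\<^esup> = 0\<close>, and the definition of \<open>Y\<close> says that \<open>X J\<^bsup>k\<^esup> Y\<close> is \<open>0\<close> for \<open>k < m - 1\<close> and \<open>A\<^sub>m\<inverse>\<close> for
  \<open>k = m - 1\<close>. Telescoping then gives \<open>P(z) X (zI - J)\<inverse> Y = I\<close>. For \<open>Y\<close> to have this property, the
  stacked matrix of the \<open>X J\<^bsup>k\<^esup>\<close> has to be invertible. It is square because the chain lengths add up to
  the degree \<open>n m\<close> of \<open>det P\<close>. It is injective because the vectors \<open>v\<close> with \<open>X J\<^bsup>k\<^esup> v = 0\<close> for all \<open>k\<close> form
  a \<open>J\<close>-invariant subspace: if it were nonzero it would contain an eigenvector of \<open>J\<close>, which \<open>X\<close> maps to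
  a linear combination of the first vectors of the chains for a single eigenvalue, and these are
  linearly independent (\<open>trivial_common_kernel\<close>).
\<close>

section \<open>Components squeezed between two discs\<close>

text \<open>
  The nearest point of the disc lies on the segment from \<open>x\<close> to the centre.
\<close>

lemma infdist_cball_le:
  fixes c x :: "'a::real_normed_vector"
  assumes "0 \<le> r"
  shows "infdist x (cball c r) \<le> max 0 (dist c x - r)"
proof (cases "dist c x \<le> r")
  case True
  then show ?thesis by (simp add: infdist_zero)
next
  case False
  let ?y = "c + (r / dist c x) *\<^sub>R (x - c)"
  have pos: "dist c x > 0" using False assms by linarith
  have "norm (?y - c) = r" using pos assms by (simp add: dist_norm norm_minus_commute)
  then have "?y \<in> cball c r" by (simp add: dist_norm norm_minus_commute)
  have "x - ?y = (1 - r / dist c x) *\<^sub>R (x - c)" by (simp add: algebra_simps)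
  then have "dist x ?y = \<bar>1 - r / dist c x\<bar> * dist c x"
    by (simp add: dist_norm norm_minus_commute)
  moreover have "r / dist c x \<le> 1" using False pos by simp
  ultimately have "dist x ?y = dist c x - r"
    using pos by (simp add: algebra_simps)
  with \<open>?y \<in> cball c r\<close> show ?thesis using infdist_le2[of ?y "cball c r" x "dist c x - r"] by simp
qed

lemma hausdorff_distance_cball_le:
  assumes in_C: "cball c a \<subseteq> C" and C_in: "C \<subseteq> cball c b"
    and "0 \<le> a" "0 \<le> d" "d - a \<le> e" "b - d \<le> e" "0 \<le> e"
  shows "\<bar>hausdorff_distance C (cball c d)\<bar> \<le> e"
proof -
  have c: "c \<in> C" using in_C \<open>0 \<le> a\<close> by auto
  have 1: "infdist s (cball c d) \<le> e" if "s \<in> C" for s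
    using infdist_cball_le[of d s c] that C_in assms by fastforce
  have 2: "infdist t C \<le> e" if "t \<in> cball c d" for t
  proof -
    have "infdist t C \<le> infdist t (cball c a)" using in_C \<open>0 \<le> a\<close> by (intro infdist_mono) auto
    also have "\<dots> \<le> max 0 (dist c t - a)" by (rule infdist_cball_le) fact
    also have "\<dots> \<le> e" using that assms by auto
    finally show ?thesis .
  qed
  have "(SUP s\<in>C. infdist s (cball c d)) \<le> e" using c 1 by (intro cSUP_least) auto
  moreover have "(SUP t\<in>cball c d. infdist t C) \<le> e" using \<open>0 \<le> d\<close> 2 by (intro cSUP_least) auto
  moreover have "0 \<le> (SUP s\<in>C. infdist s (cball c d))"
    using c 1 by (intro cSUP_upper2[of _ _ c]) (auto intro!: bdd_aboveI2[of _ _ e] infdist_nonneg)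
  ultimately show ?thesis unfolding hausdorff_distance_def by auto
qed

text \<open>
  The distances from \<open>c\<close> to the points of the component form an interval that contains \<open>0\<close>. It misses
  all values strictly between \<open>b\<close> and \<open>r\<close>, so it cannot reach beyond \<open>b\<close>.
\<close>

lemma connected_component_subset_cball:
  fixes c :: "'a::metric_space"
  assumes "b < r" and avoid: "\<And>z. b < dist c z \<Longrightarrow> dist c z < r \<Longrightarrow> z \<notin> S"
    and "0 \<le> b"
  shows "connected_component_set S c \<subseteq> cball c b"
proof (rule ccontr)
  let ?C = "connected_component_set S c"
  assume "\<not> ?thesis"
  then obtain z where "z \<in> ?C" "z \<notin> cball c b" by blast
  then have z: "z \<in> ?C" "b < dist c z" by auto
  define \<rho> where "\<rho> = (b + min r (dist c z)) / 2"
  have \<rho>: "b < \<rho>" "\<rho> < r" "\<rho> < dist c z" using z assms by (auto simp: \<rho>_def min_def)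
  have "c \<in> ?C" using z by (metis connected_component_in connected_component_refl mem_Collect_eq)
  moreover have "connected (dist c ` ?C)"
    by (intro connected_continuous_image continuous_intros connected_connected_component)
  ultimately have "\<rho> \<in> dist c ` ?C"
    using connectedD_interval[of "dist c ` ?C" "dist c c" "dist c z" \<rho>] z \<rho> \<open>0 \<le> b\<close> by auto
  then obtain y where "y \<in> ?C" "dist c y = \<rho>" by blast
  then show False using avoid[of y] \<rho> connected_component_subset[of S c] by auto
qed

lemma cball_subset_connected_component:
  fixes c :: "'a::real_normed_vector"
  assumes "cball c a \<subseteq> S"
  shows "cball c a \<subseteq> connected_component_set S c"
proof
  fix z assume z: "z \<in> cball c a"
  let ?f = "\<lambda>t. c + t *\<^sub>R (z - c)"
  have "?f t \<in> cball c a" if "t \<in> {0..1}" for t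
  proof -
    have "norm (?f t - c) \<le> 1 * norm (z - c)"
      using that by (auto intro!: mult_left_le_one_le)
    then show ?thesis using z by (auto simp: dist_norm norm_minus_commute)
  qed
  moreover have "connected (?f ` {0..1})"
    by (intro connected_continuous_image continuous_intros connected_Icc)
  moreover have "?f 0 \<in> ?f ` {0..1}" "?f 1 \<in> ?f ` {0..1}" by (intro imageI; simp)+
  then have "c \<in> ?f ` {0..1}" "z \<in> ?f ` {0..1}" by simp_all
  ultimately show "z \<in> connected_component_set S c"
    using assms unfolding connected_component_def by blast
qed

text \<open>
  The two hypotheses describe \<open>S \<epsilon>\<close> near \<open>c\<close> as \<open>{z. |z - c|\<^bsup>p\<^esup> \<le> \<epsilon> \<phi>(z)}\<close>, up to the boundary. The
  neighbourhood in which they hold is independent of \<open>\<epsilon>\<close>; this uniformity keeps the component from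
  escaping through the annulus around the outer disc. After division by \<open>\<epsilon>\<^bsup>1/p\<^esup>\<close> the radii of the inner, the
  given and the outer disc are \<open>max 0 (K - \<delta>)\<close>, \<open>K\<close> and \<open>K + \<delta>\<close> to the power \<open>1/p\<close>, so continuity of the
  root at \<open>K\<close> turns a small \<open>\<delta>\<close> into a small distance.
\<close>

lemma hausdorff_distance_component_smallo:
  fixes S :: "real \<Rightarrow> complex set" and K :: real and p :: nat
  assumes "p > 0" "K \<ge> 0"
    and centre: "\<And>\<epsilon>. \<epsilon> > 0 \<Longrightarrow> c \<in> S \<epsilon>"
    and lim: "(\<phi> \<longlongrightarrow> K) (at c)"
    and inside: "\<forall>\<^sub>F z in at c. \<forall>\<epsilon>>0. norm (z - c) ^ p < \<epsilon> * \<phi> z \<longrightarrow> z \<in> S \<epsilon>"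
    and outside: "\<forall>\<^sub>F z in at c. \<forall>\<epsilon>>0. \<epsilon> * \<phi> z < norm (z - c) ^ p \<longrightarrow> z \<notin> S \<epsilon>"
  shows "(\<lambda>\<epsilon>. hausdorff_distance (connected_component_set (S \<epsilon>) c)
            (cball c ((K * \<epsilon>) powr (1 / real p))))
         \<in> o[at_right 0](\<lambda>\<epsilon>. \<epsilon> powr (1 / real p))"
proof (rule landau_o.smallI)
  fix \<eta> :: real assume "\<eta> > 0"
  have root: "x powr (1 / real p) = root p x" if "x \<ge> 0" for x
    using that \<open>p > 0\<close> by (cases "x = 0") (auto simp: root_powr_inverse)
  have "((\<lambda>\<delta>. root p (K + \<delta>)) \<longlongrightarrow> root p (K + 0)) (at_right 0)"
    by (intro tendsto_intros)
  moreover have "((\<lambda>\<delta>. root p (max 0 (K - \<delta>))) \<longlongrightarrow> root p (max 0 (K - 0))) (at_right 0)"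
    by (intro tendsto_intros)
  ultimately have "\<forall>\<^sub>F \<delta> in at_right 0.
      dist (root p (K + \<delta>)) (root p K) < \<eta> \<and> dist (root p (max 0 (K - \<delta>))) (root p K) < \<eta>"
    using \<open>\<eta> > 0\<close> \<open>K \<ge> 0\<close> by (auto simp: tendsto_iff eventually_conj_iff)
  then have "\<exists>\<delta>>0. dist (root p (K + \<delta>)) (root p K) < \<eta> \<and> dist (root p (max 0 (K - \<delta>))) (root p K) < \<eta>"
    unfolding eventually_at_right_field by (metis field_lbound_gt_zero dense)
  then obtain \<delta> where "\<delta> > 0" and \<delta>: "root p (K + \<delta>) - root p K \<le> \<eta>"
      "root p K - root p (max 0 (K - \<delta>)) \<le> \<eta>"
    by (auto simp: dist_real_def abs_if split: if_splits)
  define a where "a = (\<lambda>\<epsilon>. root p (max 0 (K - \<delta>) * \<epsilon>))"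
  define b where "b = (\<lambda>\<epsilon>. root p ((K + \<delta>) * \<epsilon>))"
  have "\<forall>\<^sub>F z in at c. \<bar>\<phi> z - K\<bar> < \<delta>"
    using lim \<open>\<delta> > 0\<close> by (auto simp: tendsto_iff dist_real_def)
  then have "\<forall>\<^sub>F z in at c. \<bar>\<phi> z - K\<bar> < \<delta> \<and> (\<forall>\<epsilon>>0. norm (z - c) ^ p < \<epsilon> * \<phi> z \<longrightarrow> z \<in> S \<epsilon>) \<and>
      (\<forall>\<epsilon>>0. \<epsilon> * \<phi> z < norm (z - c) ^ p \<longrightarrow> z \<notin> S \<epsilon>)"
    using inside outside by eventually_elim auto
  then obtain r where "r > 0" and r: "\<And>z. z \<noteq> c \<Longrightarrow> dist z c < r \<Longrightarrow> \<bar>\<phi> z - K\<bar> < \<delta> \<and>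
      (\<forall>\<epsilon>>0. norm (z - c) ^ p < \<epsilon> * \<phi> z \<longrightarrow> z \<in> S \<epsilon>) \<and>
      (\<forall>\<epsilon>>0. \<epsilon> * \<phi> z < norm (z - c) ^ p \<longrightarrow> z \<notin> S \<epsilon>)"
    unfolding eventually_at by blast
  have "(b \<longlongrightarrow> root p ((K + \<delta>) * 0)) (at_right 0)"
    unfolding b_def by (intro tendsto_intros)
  then have "\<forall>\<^sub>F \<epsilon> in at_right 0. b \<epsilon> < r"
    using \<open>r > 0\<close> by (intro order_tendstoD) auto
  moreover have "\<forall>\<^sub>F \<epsilon> in at_right (0::real). \<epsilon> > 0" by (simp add: eventually_at_right_less)
  ultimately show "\<forall>\<^sub>F \<epsilon> in at_right 0.
      norm (hausdorff_distance (connected_component_set (S \<epsilon>) c) (cball c ((K * \<epsilon>) powr (1 / real p))))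
      \<le> \<eta> * norm (\<epsilon> powr (1 / real p))"
  proof eventually_elim
    case (elim \<epsilon>)
    have ab: "0 \<le> a \<epsilon>" "a \<epsilon> \<le> b \<epsilon>" "0 \<le> b \<epsilon>"
      using elim \<open>\<delta> > 0\<close> \<open>K \<ge> 0\<close> \<open>p > 0\<close>
      by (auto simp: a_def b_def intro!: mult_right_mono)
    have ap: "a \<epsilon> ^ p = max 0 (K - \<delta>) * \<epsilon>" "b \<epsilon> ^ p = (K + \<delta>) * \<epsilon>"
      using elim \<open>p > 0\<close> \<open>\<delta> > 0\<close> \<open>K \<ge> 0\<close> by (auto simp: a_def b_def)
    have "cball c (a \<epsilon>) \<subseteq> S \<epsilon>"
    proof
      fix z assume z: "z \<in> cball c (a \<epsilon>)"
      show "z \<in> S \<epsilon>"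
      proof (cases "z = c")
        case True then show ?thesis using centre elim by simp
      next
        case False
        have z': "norm (z - c) \<le> a \<epsilon>" using z by (simp add: dist_norm norm_minus_commute)
        then have "0 < a \<epsilon>" using False by (smt (verit) zero_less_norm_iff right_minus_eq)
        then have "K - \<delta> > 0" unfolding a_def using \<open>p > 0\<close> elim
            by (auto simp: max_def zero_less_mult_iff split: if_splits)
        have le: "norm (z - c) ^ p \<le> (K - \<delta>) * \<epsilon>"
          using power_mono[OF z', of p] ap(1) \<open>K - \<delta> > 0\<close> by (simp add: max_def)
        have "dist z c < r" using z' ab elim by (simp add: dist_norm)
        note R = r[OF False this]
        have "(K - \<delta>) * \<epsilon> < \<phi> z * \<epsilon>" using R elim by (intro mult_strict_right_mono) auto
        then have "norm (z - c) ^ p < \<epsilon> * \<phi> z" using le by (simp add: mult.commute)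
        then show ?thesis using R elim by blast
      qed
    qed
    then have in_C: "cball c (a \<epsilon>) \<subseteq> connected_component_set (S \<epsilon>) c"
      by (rule cball_subset_connected_component)
    have C_in: "connected_component_set (S \<epsilon>) c \<subseteq> cball c (b \<epsilon>)"
    proof (rule connected_component_subset_cball)
      show "b \<epsilon> < r" "0 \<le> b \<epsilon>" using elim ab by auto
      fix z assume z: "b \<epsilon> < dist c z" "dist c z < r"
      then have "z \<noteq> c" using ab by auto
      have "dist z c < r" using z by (simp add: dist_commute)
      note R = r[OF \<open>z \<noteq> c\<close> this]
      have "\<phi> z < K + \<delta>" using R by linarith
      then have "\<epsilon> * \<phi> z < (K + \<delta>) * \<epsilon>" using elim by (simp add: mult.commute)
      also have "\<dots> = b \<epsilon> ^ p" using ap by simp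
      also have "\<dots> < norm (z - c) ^ p"
        using z ab \<open>p > 0\<close> by (intro power_strict_mono) (auto simp: dist_norm norm_minus_commute)
      finally show "z \<notin> S \<epsilon>" using R elim by auto
    qed
    have mono: "x * root p \<epsilon> \<le> \<eta> * root p \<epsilon>" if "x \<le> \<eta>" for x
      using that elim \<open>p > 0\<close> by (intro mult_right_mono) auto
    have "\<bar>hausdorff_distance (connected_component_set (S \<epsilon>) c) (cball c (root p (K * \<epsilon>)))\<bar>
        \<le> \<eta> * root p \<epsilon>"
    proof (rule hausdorff_distance_cball_le[OF in_C C_in])
      show "root p (K * \<epsilon>) - a \<epsilon> \<le> \<eta> * root p \<epsilon>" "b \<epsilon> - root p (K * \<epsilon>) \<le> \<eta> * root p \<epsilon>"
        using mono[OF \<delta>(1)] mono[OF \<delta>(2)]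
        unfolding a_def b_def real_root_mult left_diff_distrib by simp_all
    qed (use ab elim \<open>K \<ge> 0\<close> \<open>\<eta> > 0\<close> \<open>p > 0\<close> in auto)
    then show ?case using root elim \<open>K \<ge> 0\<close> \<open>p > 0\<close> by simp
  qed
qed

section \<open>Euclidean and spectral norm\<close>

lemma mult_mat_index_sum:
  assumes "P \<in> carrier_mat nr N" "Q \<in> carrier_mat N nc" "i < nr" "j < nc"
  shows "(P * Q) $$ (i, j) = (\<Sum>a<N. P $$ (i, a) * (Q $$ (a, j) :: complex))"
  using assms by (simp add: scalar_prod_def atLeast0LessThan)

lemma mult_mat_vec_index_sum:
  assumes "M \<in> carrier_mat nr N" "v \<in> carrier_vec N" "i < nr"
  shows "(M *\<^sub>v v) $ i = (\<Sum>a<N. M $$ (i, a) * (v $ a :: complex))"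
  using assms by (simp add: scalar_prod_def atLeast0LessThan)

lemma euclid_norm_eq_L2_set: "euclid_norm v = L2_set (\<lambda>i. cmod (v $ i)) {..<dim_vec v}"
  by (simp add: euclid_norm_def L2_set_def)

lemma euclid_norm_nonneg [simp]: "0 \<le> euclid_norm v"
  by (simp add: euclid_norm_eq_L2_set)

lemma euclid_norm_zero [simp]: "euclid_norm (0\<^sub>v n) = 0"
  by (simp add: euclid_norm_def)

lemma euclid_norm_eq_0_iff: "v \<in> carrier_vec n \<Longrightarrow> euclid_norm v = 0 \<longleftrightarrow> v = 0\<^sub>v n"
  by (auto simp: euclid_norm_eq_L2_set L2_set_eq_0_iff)

lemma euclid_norm_smult: "euclid_norm (a \<cdot>\<^sub>v v) = cmod a * euclid_norm v"
  by (simp add: euclid_norm_eq_L2_set L2_set_right_distrib norm_mult cong: L2_set_cong_simp)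

lemma euclid_norm_uminus: "euclid_norm (- v) = euclid_norm v"
  by (simp add: euclid_norm_def)

lemma euclid_norm_triangle:
  assumes "v \<in> carrier_vec n" "u \<in> carrier_vec n"
  shows "euclid_norm (v + u) \<le> euclid_norm v + euclid_norm u"
proof -
  have "euclid_norm (v + u) \<le> L2_set (\<lambda>i. cmod (v $ i) + cmod (u $ i)) {..<n}"
    unfolding euclid_norm_eq_L2_set using assms
    by (auto intro!: L2_set_mono norm_triangle_ineq)
  also have "\<dots> \<le> euclid_norm v + euclid_norm u"
    using assms by (simp add: euclid_norm_eq_L2_set L2_set_triangle_ineq)
  finally show ?thesis .
qed

lemma norm_index_le_euclid_norm: "i < dim_vec v \<Longrightarrow> cmod (v $ i) \<le> euclid_norm v"
  unfolding euclid_norm_eq_L2_set by (rule member_le_L2_set) auto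

text \<open>
  A crude bound, which shows that the supremum in the definition of the spectral norm is finite and
  that the spectral norm depends continuously on the entries.
\<close>

lemma euclid_norm_mult_mat_vec_le_entries:
  assumes "x \<in> carrier_vec (dim_col M)"
  shows "euclid_norm (M *\<^sub>v x) \<le> (\<Sum>i<dim_row M. \<Sum>j<dim_col M. cmod (M $$ (i, j))) * euclid_norm x"
proof -
  have "euclid_norm (M *\<^sub>v x) \<le> (\<Sum>i<dim_row M. cmod ((M *\<^sub>v x) $ i))"
    unfolding euclid_norm_eq_L2_set using L2_set_le_sum_abs[of "\<lambda>i. cmod ((M *\<^sub>v x) $ i)"]
    by (simp del: index_mult_mat_vec)
  also have "\<dots> \<le> (\<Sum>i<dim_row M. \<Sum>j<dim_col M. cmod (M $$ (i, j)) * euclid_norm x)"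
  proof (rule sum_mono)
    fix i assume "i \<in> {..<dim_row M}"
    then have "(M *\<^sub>v x) $ i = (\<Sum>j<dim_col M. M $$ (i, j) * x $ j)"
      using assms by (intro mult_mat_vec_index_sum) auto
    also have "cmod \<dots> \<le> (\<Sum>j<dim_col M. cmod (M $$ (i, j)) * cmod (x $ j))"
      by (rule order_trans[OF norm_sum]) (simp add: norm_mult)
    also have "\<dots> \<le> (\<Sum>j<dim_col M. cmod (M $$ (i, j)) * euclid_norm x)"
      using assms by (intro sum_mono mult_left_mono norm_index_le_euclid_norm) auto
    finally show "cmod ((M *\<^sub>v x) $ i) \<le> (\<Sum>j<dim_col M. cmod (M $$ (i, j)) * euclid_norm x)" .
  qed
  finally show ?thesis by (simp add: sum_distrib_right)
qed

lemma bdd_above_spectral_norm: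
  "bdd_above ((\<lambda>x. euclid_norm (M *\<^sub>v x)) ` {x \<in> carrier_vec (dim_col M). euclid_norm x \<le> 1})"
proof (rule bdd_aboveI2)
  fix x assume x: "x \<in> {x \<in> carrier_vec (dim_col M). euclid_norm x \<le> 1}"
  have "(\<Sum>i<dim_row M. \<Sum>j<dim_col M. cmod (M $$ (i, j))) * euclid_norm x
      \<le> (\<Sum>i<dim_row M. \<Sum>j<dim_col M. cmod (M $$ (i, j))) * 1"
    using x by (intro mult_left_mono) (auto intro!: sum_nonneg)
  then show "euclid_norm (M *\<^sub>v x) \<le> (\<Sum>i<dim_row M. \<Sum>j<dim_col M. cmod (M $$ (i, j)))"
    using euclid_norm_mult_mat_vec_le_entries[of x M] x by auto
qed

lemma spectral_norm_nonneg: "0 \<le> spectral_norm M"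
  unfolding spectral_norm_def
  by (intro cSUP_upper2[OF bdd_above_spectral_norm, of "0\<^sub>v (dim_col M)"]) auto

lemma euclid_norm_mult_mat_vec_le:
  assumes "x \<in> carrier_vec (dim_col M)"
  shows "euclid_norm (M *\<^sub>v x) \<le> spectral_norm M * euclid_norm x"
proof (cases "euclid_norm x = 0")
  case True
  then show ?thesis using euclid_norm_mult_mat_vec_le_entries[OF assms] by simp
next
  case False
  let ?a = "complex_of_real (euclid_norm x)"
  let ?y = "inverse ?a \<cdot>\<^sub>v x"
  have "euclid_norm ?y \<le> 1"
    using False by (simp add: euclid_norm_smult norm_inverse)
  then have le: "euclid_norm (M *\<^sub>v ?y) \<le> spectral_norm M"
    unfolding spectral_norm_def using assms
    by (intro cSUP_upper[OF _ bdd_above_spectral_norm]) auto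
  have "M *\<^sub>v ?y = inverse ?a \<cdot>\<^sub>v (M *\<^sub>v x)"
    using assms by (intro mult_mat_vec[of _ "dim_row M" "dim_col M"]) auto
  then have "euclid_norm (M *\<^sub>v x) / euclid_norm x \<le> spectral_norm M"
    using le by (simp add: euclid_norm_smult norm_inverse divide_inverse mult.commute)
  then show ?thesis using False
    by (simp add: divide_le_eq order_less_le)
qed

lemma spectral_norm_leI:
  assumes "\<And>x. x \<in> carrier_vec (dim_col M) \<Longrightarrow> euclid_norm x \<le> 1 \<Longrightarrow> euclid_norm (M *\<^sub>v x) \<le> c"
  shows "spectral_norm M \<le> c"
  unfolding spectral_norm_def using assms
  by (intro cSUP_least) (auto intro!: exI[of _ "0\<^sub>v (dim_col M)"])

lemma less_spectral_normE:
  assumes "c < spectral_norm M"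
  obtains x where "x \<in> carrier_vec (dim_col M)" "euclid_norm x \<le> 1" "c < euclid_norm (M *\<^sub>v x)"
  using assms spectral_norm_leI[of M c] by (meson not_le)

lemma spectral_norm_triangle:
  assumes "M \<in> carrier_mat nr nc" "M' \<in> carrier_mat nr nc"
  shows "spectral_norm (M + M') \<le> spectral_norm M + spectral_norm M'"
proof (rule spectral_norm_leI)
  fix x assume "x \<in> carrier_vec (dim_col (M + M'))" and x1: "euclid_norm x \<le> 1"
  then have x: "x \<in> carrier_vec nc" using assms by simp
  have "euclid_norm ((M + M') *\<^sub>v x) \<le> euclid_norm (M *\<^sub>v x) + euclid_norm (M' *\<^sub>v x)"
    using assms x by (subst add_mult_distrib_mat_vec[OF assms x]) (auto intro!: euclid_norm_triangle[of _ nr])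
  also have "\<dots> \<le> spectral_norm M * euclid_norm x + spectral_norm M' * euclid_norm x"
    using assms x by (intro add_mono euclid_norm_mult_mat_vec_le) auto
  also have "\<dots> \<le> spectral_norm M * 1 + spectral_norm M' * 1"
    using x1 by (intro add_mono mult_left_mono spectral_norm_nonneg)
  finally show "euclid_norm ((M + M') *\<^sub>v x) \<le> spectral_norm M + spectral_norm M'" by simp
qed

lemma smult_mat_mult_vec:
  assumes "x \<in> carrier_vec (dim_col M)"
  shows "(a \<cdot>\<^sub>m M) *\<^sub>v x = a \<cdot>\<^sub>v (M *\<^sub>v (x :: complex vec))"
  using assms by (intro eq_vecI) (auto simp: scalar_prod_def sum_distrib_left mult.assoc)

lemma spectral_norm_smult: "spectral_norm (a \<cdot>\<^sub>m M) = cmod a * spectral_norm M"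
proof (rule antisym)
  have le: "spectral_norm (b \<cdot>\<^sub>m N) \<le> cmod b * spectral_norm N" for b N
  proof (rule spectral_norm_leI)
    fix x assume "x \<in> carrier_vec (dim_col (b \<cdot>\<^sub>m N))" and x1: "euclid_norm x \<le> 1"
    then have x: "x \<in> carrier_vec (dim_col N)" by simp
    have "euclid_norm (N *\<^sub>v x) \<le> spectral_norm N * euclid_norm x"
      by (rule euclid_norm_mult_mat_vec_le[OF x])
    also have "\<dots> \<le> spectral_norm N * 1" using x1 by (intro mult_left_mono spectral_norm_nonneg)
    finally show "euclid_norm ((b \<cdot>\<^sub>m N) *\<^sub>v x) \<le> cmod b * spectral_norm N"
      using x by (simp add: smult_mat_mult_vec euclid_norm_smult mult_left_mono)
  qed
  show "spectral_norm (a \<cdot>\<^sub>m M) \<le> cmod a * spectral_norm M" by (rule le)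
  show "cmod a * spectral_norm M \<le> spectral_norm (a \<cdot>\<^sub>m M)"
  proof (cases "a = 0")
    case False
    have "inverse a \<cdot>\<^sub>m (a \<cdot>\<^sub>m M) = M" using False by (intro eq_matI) auto
    then show ?thesis using le[of "inverse a" "a \<cdot>\<^sub>m M"] False by (simp add: norm_inverse norm_divide field_simps)
  qed (simp add: spectral_norm_nonneg)
qed

lemma spectral_norm_le_entries:
  "spectral_norm M \<le> (\<Sum>i<dim_row M. \<Sum>j<dim_col M. cmod (M $$ (i, j)))"
proof (rule spectral_norm_leI)
  fix x assume x: "x \<in> carrier_vec (dim_col M)" "euclid_norm x \<le> 1"
  have "(\<Sum>i<dim_row M. \<Sum>j<dim_col M. cmod (M $$ (i, j))) * euclid_norm x
      \<le> (\<Sum>i<dim_row M. \<Sum>j<dim_col M. cmod (M $$ (i, j))) * 1"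
    using x by (intro mult_left_mono) (auto intro!: sum_nonneg)
  then show "euclid_norm (M *\<^sub>v x) \<le> (\<Sum>i<dim_row M. \<Sum>j<dim_col M. cmod (M $$ (i, j)))"
    using euclid_norm_mult_mat_vec_le_entries[of x M] x by auto
qed

lemma spectral_norm_diff_le:
  assumes "M \<in> carrier_mat nr nc" "M' \<in> carrier_mat nr nc"
  shows "spectral_norm M - spectral_norm M' \<le> (\<Sum>i<nr. \<Sum>j<nc. cmod (M $$ (i, j) - M' $$ (i, j)))"
proof -
  have "M' + (M - M') = M" using assms by (intro eq_matI) auto
  then have "spectral_norm M \<le> spectral_norm M' + spectral_norm (M - M')"
    using spectral_norm_triangle[OF assms(2) minus_carrier_mat[OF assms(2)], of M] by simp
  moreover have "spectral_norm (M - M') \<le> (\<Sum>i<nr. \<Sum>j<nc. cmod (M $$ (i, j) - M' $$ (i, j)))"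
    using spectral_norm_le_entries[of "M - M'"] assms by (auto intro!: sum.cong)
  ultimately show ?thesis by simp
qed

lemma tendsto_spectral_norm:
  assumes "\<And>z. M z \<in> carrier_mat nr nc" "G \<in> carrier_mat nr nc"
    and entry: "\<And>i j. i < nr \<Longrightarrow> j < nc \<Longrightarrow> ((\<lambda>z. M z $$ (i, j)) \<longlongrightarrow> G $$ (i, j)) F"
  shows "((\<lambda>z. spectral_norm (M z)) \<longlongrightarrow> spectral_norm G) F"
proof (rule metric_tendsto_imp_tendsto)
  show "\<forall>\<^sub>F z in F. dist (spectral_norm (M z)) (spectral_norm G)
      \<le> dist (\<Sum>i<nr. \<Sum>j<nc. cmod (M z $$ (i, j) - G $$ (i, j))) 0"
    using spectral_norm_diff_le[OF assms(1,2)] spectral_norm_diff_le[OF assms(2,1)]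
    by (intro always_eventually allI)
      (simp add: dist_real_def abs_le_iff norm_minus_commute sum_nonneg)
  have "((\<lambda>z. \<Sum>i<nr. \<Sum>j<nc. cmod (M z $$ (i, j) - G $$ (i, j))) \<longlongrightarrow>
      (\<Sum>i<nr. \<Sum>j<nc. cmod (G $$ (i, j) - G $$ (i, j)))) F"
    by (intro tendsto_intros entry) auto
  then show "((\<lambda>z. \<Sum>i<nr. \<Sum>j<nc. cmod (M z $$ (i, j) - G $$ (i, j))) \<longlongrightarrow> 0) F" by simp
qed

section \<open>Pseudospectrum and norm of the inverse\<close>

lemma mat_poly_eval_carrier [simp]: "mat_poly_eval n m A z \<in> carrier_mat n n"
  by (simp add: mat_poly_eval_def mat_poly_def)

lemma mat_poly_eval_dim [simp]:
  "dim_row (mat_poly_eval n m A z) = n" "dim_col (mat_poly_eval n m A z) = n"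
  by (simp_all add: mat_poly_eval_def mat_poly_def)

lemma mat_poly_eval_add:
  assumes "\<And>j. j \<le> m \<Longrightarrow> D j \<in> carrier_mat n n"
  shows "mat_poly_eval n m (\<lambda>j. A j + D j) z = mat_poly_eval n m A z + mat_poly_eval n m D z"
proof (rule eq_matI)
  fix i j assume "i < dim_row (mat_poly_eval n m A z + mat_poly_eval n m D z)"
    "j < dim_col (mat_poly_eval n m A z + mat_poly_eval n m D z)"
  then have ij: "i < n" "j < n" by auto
  have "(A k + D k) $$ (i, j) = A k $$ (i, j) + D k $$ (i, j)" if "k \<le> m" for k
    using assms[OF that] ij by auto
  then show "mat_poly_eval n m (\<lambda>j. A j + D j) z $$ (i, j)
      = (mat_poly_eval n m A z + mat_poly_eval n m D z) $$ (i, j)"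
    using ij by (simp add: mat_poly_eval_index sum.distrib distrib_right)
qed auto

lemma spectral_norm_mat_poly_eval_le:
  assumes "\<And>j. j \<le> m \<Longrightarrow> D j \<in> carrier_mat n n"
  shows "spectral_norm (mat_poly_eval n m D z) \<le> (\<Sum>j\<le>m. spectral_norm (D j) * cmod z ^ j)"
  using assms
proof (induction m)
  case 0
  have "mat_poly_eval n 0 D z = D 0"
    using 0[of 0] by (intro eq_matI) (auto simp: mat_poly_eval_index)
  then show ?case by simp
next
  case (Suc m)
  have "mat_poly_eval n (Suc m) D z = mat_poly_eval n m D z + z ^ Suc m \<cdot>\<^sub>m D (Suc m)"
    using Suc.prems[of "Suc m"] by (intro eq_matI) (auto simp: mat_poly_eval_index)
  then have "spectral_norm (mat_poly_eval n (Suc m) D z)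
      \<le> spectral_norm (mat_poly_eval n m D z) + cmod z ^ Suc m * spectral_norm (D (Suc m))"
    using spectral_norm_triangle[of "mat_poly_eval n m D z" n n "z ^ Suc m \<cdot>\<^sub>m D (Suc m)"]
      Suc.prems[of "Suc m"] by (simp add: spectral_norm_smult norm_power norm_mult)
  then show ?case using Suc by (simp add: mult.commute)
qed

text \<open>
  If \<open>(P + D) v = 0\<close> with \<open>P = P(z)\<close> and the perturbation \<open>D = D(z)\<close>, then \<open>v = - R D v\<close>, which is
  shorter than \<open>v\<close> unless \<open>v = 0\<close>.
\<close>

lemma not_in_pseudospectrum:
  assumes R: "R \<in> carrier_mat n n" and inv: "mat_poly_eval n m A z * R = 1\<^sub>m n"
    and small: "\<epsilon> * weight m w (cmod z) * spectral_norm R < 1"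
  shows "z \<notin> pseudospectrum n m A w \<epsilon>"
proof
  let ?P = "mat_poly_eval n m A z"
  assume "z \<in> pseudospectrum n m A w \<epsilon>"
  then obtain D where D: "\<And>j. j \<le> m \<Longrightarrow> D j \<in> carrier_mat n n"
      "\<And>j. j \<le> m \<Longrightarrow> spectral_norm (D j) \<le> \<epsilon> * w j"
    and det: "Determinant.det (mat_poly_eval n m (\<lambda>j. A j + D j) z) = 0"
    unfolding pseudospectrum_def by blast
  let ?D = "mat_poly_eval n m D z"
  have "spectral_norm ?D \<le> (\<Sum>j\<le>m. spectral_norm (D j) * cmod z ^ j)"
    by (rule spectral_norm_mat_poly_eval_le) (rule D)
  also have "\<dots> \<le> (\<Sum>j\<le>m. \<epsilon> * w j * cmod z ^ j)"
    by (intro sum_mono mult_right_mono D) auto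
  also have "\<dots> = \<epsilon> * weight m w (cmod z)" by (simp add: weight_def sum_distrib_left mult.assoc)
  finally have D_le: "spectral_norm ?D \<le> \<epsilon> * weight m w (cmod z)" .
  have "Determinant.det (?P + ?D) = 0" using det D(1) by (simp add: mat_poly_eval_add)
  then obtain v where v: "v \<in> carrier_vec n" "v \<noteq> 0\<^sub>v n" "(?P + ?D) *\<^sub>v v = 0\<^sub>v n"
    using det_0_iff_vec_prod_zero[of "?P + ?D" n] by auto
  have "R * ?P = 1\<^sub>m n" using mat_mult_left_right_inverse[OF _ R inv] by simp
  then have "v = R *\<^sub>v (?P *\<^sub>v v)"
    using v R by (simp add: assoc_mult_mat_vec[symmetric, where ?n\<^sub>1.0=n and ?n\<^sub>2.0=n and ?n\<^sub>3.0=n])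
  moreover have "?P *\<^sub>v v = - (?D *\<^sub>v v)"
  proof -
    have "?P *\<^sub>v v + ?D *\<^sub>v v = 0\<^sub>v n"
      using v add_mult_distrib_mat_vec[of ?P n n ?D v] by simp
    then show ?thesis
      by (intro eq_vecI) (auto simp: vec_eq_iff eq_neg_iff_add_eq_0 mat_poly_eval_def mat_poly_def)
  qed
  ultimately have "euclid_norm v = euclid_norm (R *\<^sub>v (- (?D *\<^sub>v v)))" by simp
  also have "\<dots> \<le> spectral_norm R * euclid_norm (?D *\<^sub>v v)"
    using euclid_norm_mult_mat_vec_le[of "- (?D *\<^sub>v v)" R] R v(1)
      mult_mat_vec_carrier[of ?D n n v] by (auto simp: euclid_norm_uminus)
  also have "\<dots> \<le> spectral_norm R * (spectral_norm ?D * euclid_norm v)"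
    using v by (intro mult_left_mono euclid_norm_mult_mat_vec_le spectral_norm_nonneg) auto
  also have "\<dots> \<le> spectral_norm R * ((\<epsilon> * weight m w (cmod z)) * euclid_norm v)"
    by (intro mult_left_mono mult_right_mono D_le spectral_norm_nonneg) auto
  also have "\<dots> = (\<epsilon> * weight m w (cmod z) * spectral_norm R) * euclid_norm v" by simp
  also have "\<dots> < 1 * euclid_norm v"
    using v small euclid_norm_eq_0_iff[OF v(1)] euclid_norm_nonneg[of v]
    by (intro mult_strict_right_mono) (auto simp: order_less_le)
  finally show False by simp
qed

lemma weight_pos:
  assumes "0 < w 0" "\<And>j. j \<le> m \<Longrightarrow> 0 \<le> w j" "0 \<le> x"
  shows "0 < weight m w x"
  unfolding weight_def using assms by (intro sum_pos2[of _ 0]) auto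

text \<open>
  The mapping is \<open>u y\<^sup>* / \<parallel>y\<parallel>\<^sup>2\<close>; its norm is bounded by the Cauchy-Schwarz inequality.
\<close>

lemma rank_one_interpolation:
  assumes u: "u \<in> carrier_vec n" and y: "y \<in> carrier_vec n" "y \<noteq> 0\<^sub>v n"
  obtains E where "E \<in> carrier_mat n n" "E *\<^sub>v y = u" "spectral_norm E \<le> euclid_norm u / euclid_norm y"
proof -
  let ?y2 = "complex_of_real ((euclid_norm y)\<^sup>2)"
  define f where "f = (\<lambda>x. \<Sum>j<n. cnj (y $ j) * x $ j)"
  define E where "E = mat n n (\<lambda>(i, j). u $ i * cnj (y $ j) / ?y2)"
  have y0: "0 < euclid_norm y"
    using euclid_norm_eq_0_iff[OF y(1)] y euclid_norm_nonneg[of y] by linarith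
  have E: "E \<in> carrier_mat n n" by (simp add: E_def)
  have Ex: "E *\<^sub>v x = (f x / ?y2) \<cdot>\<^sub>v u" if "x \<in> carrier_vec n" for x
  proof (rule eq_vecI)
    fix i assume "i < dim_vec ((f x / ?y2) \<cdot>\<^sub>v u)"
    then show "(E *\<^sub>v x) $ i = ((f x / ?y2) \<cdot>\<^sub>v u) $ i"
      using mult_mat_vec_index_sum[OF E that, of i] u
      by (simp add: E_def f_def sum_distrib_left sum_distrib_right sum_divide_distrib mult_ac del: index_mult_mat_vec)
  qed (use E u in auto)
  have "f y = ?y2"
    unfolding euclid_norm_def using y
    by (simp add: f_def sum_nonneg complex_norm_square mult.commute del: of_real_power)
  then have "E *\<^sub>v y = u" using Ex[of y] y u y0 by simp
  moreover have "spectral_norm E \<le> euclid_norm u / euclid_norm y"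
  proof (rule spectral_norm_leI)
    fix x assume "x \<in> carrier_vec (dim_col E)" and x1: "euclid_norm x \<le> 1"
    then have x: "x \<in> carrier_vec n" using E by simp
    have "cmod (f x) \<le> (\<Sum>j<n. \<bar>cmod (y $ j)\<bar> * \<bar>cmod (x $ j)\<bar>)"
      unfolding f_def by (rule order_trans[OF norm_sum]) (simp add: norm_mult)
    also have "\<dots> \<le> euclid_norm y * euclid_norm x"
      using x y L2_set_mult_ineq[of "\<lambda>j. cmod (y $ j)" "\<lambda>j. cmod (x $ j)" "{..<n}"]
      by (simp add: euclid_norm_eq_L2_set)
    also have "\<dots> \<le> euclid_norm y * 1" using x1 by (intro mult_left_mono) auto
    finally have "cmod (f x) \<le> euclid_norm y" by simp
    then have "cmod (f x) / (euclid_norm y)\<^sup>2 \<le> 1 / euclid_norm y"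
      using y0 by (simp add: field_simps power2_eq_square)
    then have "cmod (f x) / (euclid_norm y)\<^sup>2 * euclid_norm u \<le> 1 / euclid_norm y * euclid_norm u"
      by (rule mult_right_mono) simp
    then show "euclid_norm (E *\<^sub>v x) \<le> euclid_norm u / euclid_norm y"
      using Ex[OF x] by (simp add: euclid_norm_smult norm_divide norm_power)
  qed
  ultimately show ?thesis using that E by blast
qed

text \<open>
  A vector \<open>u\<close> that \<open>R\<close> stretches by more than \<open>1 / (\<epsilon> w(|z|))\<close> gives \<open>y = R u\<close> with \<open>P(z) y = u\<close>, and a
  rank-one matrix \<open>E\<close> of norm at most \<open>\<epsilon> w(|z|)\<close> with \<open>(P(z) + E) y = 0\<close>. To realise \<open>E\<close> as the value at \<open>z\<close>
  of a perturbation polynomial, the \<open>j\<close>-th coefficient takes the share \<open>w\<^sub>j / w(|z|)\<close> of \<open>E\<close>, rotated such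
  that multiplication by \<open>z\<^bsup>j\<^esup>\<close> turns it into the share \<open>w\<^sub>j |z|\<^bsup>j\<^esup> / w(|z|)\<close>.
\<close>

lemma in_pseudospectrum:
  assumes R: "R \<in> carrier_mat n n" and inv: "mat_poly_eval n m A z * R = 1\<^sub>m n"
    and w: "0 < w 0" "\<And>j. j \<le> m \<Longrightarrow> 0 \<le> w j" and "0 < \<epsilon>"
    and large: "1 < \<epsilon> * weight m w (cmod z) * spectral_norm R"
  shows "z \<in> pseudospectrum n m A w \<epsilon>"
proof -
  let ?P = "mat_poly_eval n m A z"
  define W where "W = weight m w (cmod z)"
  have W: "0 < W" unfolding W_def by (rule weight_pos) (use w in auto)
  have "1 / (\<epsilon> * W) < spectral_norm R"
    using large W \<open>0 < \<epsilon>\<close> by (simp add: W_def field_simps)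
  then obtain u where u: "u \<in> carrier_vec n" "euclid_norm u \<le> 1" and "1 / (\<epsilon> * W) < euclid_norm (R *\<^sub>v u)"
    using R by (auto elim: less_spectral_normE)
  define y where "y = R *\<^sub>v u"
  have y: "y \<in> carrier_vec n" "1 / (\<epsilon> * W) < euclid_norm y"
    using u R \<open>1 / (\<epsilon> * W) < euclid_norm (R *\<^sub>v u)\<close> by (auto simp: y_def)
  have "0 < 1 / (\<epsilon> * W)" using W \<open>0 < \<epsilon>\<close> by simp
  then have y0: "0 < euclid_norm y" using y by linarith
  then have "y \<noteq> 0\<^sub>v n" by auto
  have Py: "?P *\<^sub>v y = u"
    using u R inv assoc_mult_mat_vec[of ?P n n R n u] by (simp add: y_def)
  obtain E where E: "E \<in> carrier_mat n n" "E *\<^sub>v y = - u" "spectral_norm E \<le> euclid_norm u / euclid_norm y"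
    using rank_one_interpolation[of "- u" n y] u y \<open>y \<noteq> 0\<^sub>v n\<close> by (auto simp: euclid_norm_uminus)
  have "euclid_norm u / euclid_norm y \<le> 1 / euclid_norm y"
    using u y0 by (simp add: divide_right_mono)
  also have "\<dots> \<le> \<epsilon> * W" using y y0 W \<open>0 < \<epsilon>\<close> by (simp add: field_simps)
  finally have E_le: "spectral_norm E \<le> \<epsilon> * W" using E by linarith
  \<comment> \<open>\<open>sgn (cnj z) * z\<close> is \<open>cmod z\<close>, also for \<open>z = 0\<close>, where only the coefficient \<open>D 0\<close> is nonzero.\<close>
  define D where "D = (\<lambda>j. (of_real (w j / W) * sgn (cnj z) ^ j) \<cdot>\<^sub>m E)"
  have D: "D j \<in> carrier_mat n n" for j using E by (simp add: D_def)
  have D_le: "spectral_norm (D j) \<le> \<epsilon> * w j" if "j \<le> m" for j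
  proof -
    have "norm (sgn (cnj z) ^ j) \<le> 1"
      unfolding norm_power by (intro power_le_one) (auto simp: norm_sgn)
    then have "w j / W * norm (sgn (cnj z) ^ j) \<le> w j / W * 1"
      using w(2)[OF that] W by (intro mult_left_mono) auto
    then have "cmod (of_real (w j / W) * sgn (cnj z) ^ j) \<le> w j / W"
      using w(2)[OF that] W by (simp add: norm_mult norm_divide)
    then have "spectral_norm (D j) \<le> w j / W * (\<epsilon> * W)"
      unfolding D_def spectral_norm_smult using E_le w(2)[OF that] W spectral_norm_nonneg
      by (intro mult_mono) auto
    then show ?thesis using W by (simp add: field_simps)
  qed
  have "z * cnj z = of_real (cmod z) * of_real (cmod z)"
    using complex_norm_square[of z] by (simp add: power2_eq_square)
  then have "sgn (cnj z) * z = of_real (cmod z)"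
    by (cases "z = 0") (auto simp: sgn_eq field_simps)
  then have "sgn (cnj z) ^ j * z ^ j = of_real (cmod z ^ j)" for j
    by (metis of_real_power power_mult_distrib)
  then have "(\<Sum>k\<le>m. of_real (w k / W) * sgn (cnj z) ^ k * e * z ^ k) = e" for e
  proof -
    have "(\<Sum>k\<le>m. of_real (w k / W) * sgn (cnj z) ^ k * e * z ^ k)
        = (\<Sum>k\<le>m. of_real (w k * cmod z ^ k) * (e / of_real W))"
      using \<open>\<And>j. sgn (cnj z) ^ j * z ^ j = of_real (cmod z ^ j)\<close>
      by (intro sum.cong refl) (simp add: mult_ac)
    also have "\<dots> = of_real W * (e / of_real W)"
      unfolding sum_distrib_right[symmetric] of_real_sum[symmetric] by (simp add: W_def weight_def)
    finally show ?thesis using W by simp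
  qed
  then have "mat_poly_eval n m D z = E"
    using E by (intro eq_matI) (auto simp: mat_poly_eval_index D_def)
  then have "mat_poly_eval n m (\<lambda>j. A j + D j) z *\<^sub>v y = 0\<^sub>v n"
    using D E u y Py by (simp add: mat_poly_eval_add add_mult_distrib_mat_vec[of _ n n])
  then have "Determinant.det (mat_poly_eval n m (\<lambda>j. A j + D j) z) = 0"
    using y \<open>y \<noteq> 0\<^sub>v n\<close> det_0_iff_vec_prod_zero[of "mat_poly_eval n m (\<lambda>j. A j + D j) z" n] by auto
  then show ?thesis unfolding pseudospectrum_def using D D_le by blast
qed

lemma eigenvalue_in_pseudospectrum:
  assumes "is_eigenvalue n m A l" "\<And>j. j \<le> m \<Longrightarrow> 0 \<le> w j" "0 \<le> \<epsilon>"
    and "\<And>j. j \<le> m \<Longrightarrow> A j \<in> carrier_mat n n"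
  shows "l \<in> pseudospectrum n m A w \<epsilon>"
proof -
  have "spectral_norm (0\<^sub>m n n) \<le> 0" using spectral_norm_le_entries[of "0\<^sub>m n n"] by simp
  moreover have "mat_poly_eval n m (\<lambda>j. A j + 0\<^sub>m n n) l = mat_poly_eval n m A l"
    using assms by (intro eq_matI) (auto simp: mat_poly_eval_index)
  ultimately show ?thesis using assms
    unfolding pseudospectrum_def is_eigenvalue_def
    by (auto intro!: exI[of _ "\<lambda>_. 0\<^sub>m n n"] order_trans[of "spectral_norm (0\<^sub>m n n)" 0])
qed

section \<open>Matrices in Jordan form\<close>


text \<open>
  A Jordan matrix without reference to its list of blocks: \<open>ev j\<close> is the eigenvalue of the block that
  covers position \<open>j\<close>, and \<open>pos j\<close> is the position within this block, counted from \<open>0\<close>. This makes entry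
  formulas uniform over all blocks.
\<close>

locale jordan_shift =
  fixes N :: nat and J :: "complex mat" and ev :: "nat \<Rightarrow> complex" and pos :: "nat \<Rightarrow> nat"
  assumes J_carrier: "J \<in> carrier_mat N N"
    and J_index: "\<And>i j. i < N \<Longrightarrow> j < N \<Longrightarrow>
      J $$ (i, j) = (if i = j then ev j else if Suc i = j \<and> 0 < pos j then 1 else 0)"
    and pos_le: "\<And>j. j < N \<Longrightarrow> pos j \<le> j"
    and pos_pred: "\<And>j. j < N \<Longrightarrow> 0 < pos j \<Longrightarrow> pos (j - 1) = pos j - 1"
    and ev_pred: "\<And>j. j < N \<Longrightarrow> 0 < pos j \<Longrightarrow> ev (j - 1) = ev j"
begin

lemma mult_J_index:
  assumes M: "M \<in> carrier_mat nr N" and "i < nr" "j < N"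
  shows "(M * J) $$ (i, j) = M $$ (i, j) * ev j + (if 0 < pos j then M $$ (i, j - 1) else 0)"
proof -
  have "(M * J) $$ (i, j) = (\<Sum>a<N. M $$ (i, a) * J $$ (a, j))"
    using assms J_carrier by (intro mult_mat_index_sum)
  also have "\<dots> = (\<Sum>a<N. (if a = j then M $$ (i, j) * ev j else 0)
      + (if a = j - 1 then if 0 < pos j then M $$ (i, j - 1) else 0 else 0))"
    using pos_le[OF \<open>j < N\<close>] \<open>j < N\<close>
    by (intro sum.cong refl) (auto simp: J_index split: if_splits)
  also have "\<dots> = M $$ (i, j) * ev j + (if 0 < pos j then M $$ (i, j - 1) else 0)"
    using \<open>j < N\<close> by (simp add: sum.distrib)
  finally show ?thesis .
qed

lemma J_mult_vec_index:
  assumes v: "v \<in> carrier_vec N" and "i < N"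
  shows "(J *\<^sub>v v) $ i = ev i * v $ i + (if Suc i < N \<and> 0 < pos (Suc i) then v $ Suc i else 0)"
proof -
  have "(J *\<^sub>v v) $ i = (\<Sum>a<N. J $$ (i, a) * v $ a)"
    using assms J_carrier by (intro mult_mat_vec_index_sum)
  also have "\<dots> = (\<Sum>a<N. (if a = i then ev i * v $ i else 0)
      + (if a = Suc i then if 0 < pos (Suc i) then v $ Suc i else 0 else 0))"
    using \<open>i < N\<close> by (intro sum.cong refl) (auto simp: J_index split: if_splits)
  also have "\<dots> = ev i * v $ i + (if Suc i < N \<and> 0 < pos (Suc i) then v $ Suc i else 0)"
    using \<open>i < N\<close> by (auto simp: sum.distrib)
  finally show ?thesis .
qed

lemma pow_J_index:
  assumes "i < N" "j < N"
  shows "(J ^\<^sub>m k) $$ (i, j) =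
    (if i \<le> j \<and> j - i \<le> pos j then of_nat (k choose (j - i)) * ev j ^ (k - (j - i)) else 0)"
  using assms(2)
proof (induction k arbitrary: j)
  case 0
  then show ?case using assms J_carrier by auto
next
  case (Suc k)
  have Jk: "J ^\<^sub>m k \<in> carrier_mat N N" using J_carrier by simp
  have step: "(J ^\<^sub>m Suc k) $$ (i, j) = (J ^\<^sub>m k) $$ (i, j) * ev j
      + (if 0 < pos j then (J ^\<^sub>m k) $$ (i, j - 1) else 0)"
    using mult_J_index[OF Jk assms(1) Suc.prems] by simp
  consider "i = j" | "i < j" "j - i \<le> pos j" | "\<not> (i \<le> j \<and> j - i \<le> pos j)" by linarith
  then show ?case
  proof cases
    case 1
    then show ?thesis using step Suc.IH[of j] Suc.IH[of "j - 1"] Suc.prems pos_le[of j] by auto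
  next
    case 2
    then obtain d where d: "j - i = Suc d" by (metis Suc_diff_Suc)
    then have j: "j = i + Suc d" "0 < pos j" using 2 by auto
    have "(J ^\<^sub>m Suc k) $$ (i, j) = of_nat (k choose Suc d) * ev j ^ (k - Suc d) * ev j
        + of_nat (k choose d) * ev j ^ (k - d)"
      using step Suc.IH[of j] Suc.IH[of "j - 1"] j 2 Suc.prems pos_pred[of j] ev_pred[of j] by auto
    also have "\<dots> = of_nat (Suc k choose Suc d) * ev j ^ (k - d)"
      by (cases "Suc d \<le> k") (auto simp: algebra_simps Suc_diff_Suc simp flip: power_Suc2 power_Suc)
    finally show ?thesis using 2 d by simp
  next
    case 3
    then have "\<not> (i \<le> j - 1 \<and> j - 1 - i \<le> pos j - 1)" if "0 < pos j"
      using that pos_le[OF Suc.prems] by linarith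
    then show ?thesis
      using 3 step Suc.IH[of j] Suc.IH[of "j - 1"] Suc.prems pos_pred[of j] by auto
  qed
qed

text \<open>
  The entries are those of \<open>(zI - J)\<inverse>\<close> if \<open>z\<close> is not an eigenvalue of \<open>J\<close>.
\<close>

definition resolvent :: "complex \<Rightarrow> complex mat" where
  "resolvent z = mat N N (\<lambda>(i, j). if i \<le> j \<and> j - i \<le> pos j then 1 / (z - ev j) ^ Suc (j - i) else 0)"

lemma resolvent_carrier: "resolvent z \<in> carrier_mat N N"
  by (simp add: resolvent_def)

lemma resolvent_mult_J:
  assumes z: "\<And>j. j < N \<Longrightarrow> z \<noteq> ev j"
  shows "resolvent z * J = z \<cdot>\<^sub>m resolvent z - 1\<^sub>m N"
proof (rule eq_matI)
  fix i j assume "i < dim_row (z \<cdot>\<^sub>m resolvent z - 1\<^sub>m N)" "j < dim_col (z \<cdot>\<^sub>m resolvent z - 1\<^sub>m N)"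
  then have ij: "i < N" "j < N" by auto
  define q where "q = z - ev j"
  have q: "q \<noteq> 0" "ev j = z - q" using z[of j] ij by (auto simp: q_def)
  note step = mult_J_index[OF resolvent_carrier[of z] ij]
  consider "i = j" | "i < j" "j - i \<le> pos j" | "\<not> (i \<le> j \<and> j - i \<le> pos j)" by linarith
  then show "(resolvent z * J) $$ (i, j) = (z \<cdot>\<^sub>m resolvent z - 1\<^sub>m N) $$ (i, j)"
  proof cases
    case 1
    then have "(resolvent z * J) $$ (i, j) = 1 / q * (z - q)"
      using step ij pos_le[of j] q by (auto simp: resolvent_def simp flip: q_def)
    also have "\<dots> = z * (1 / q) - 1" using q by (simp add: field_simps)
    finally show ?thesis using 1 ij by (simp add: resolvent_def q_def)
  next
    case 2
    then obtain d where d: "j - i = Suc d" by (metis Suc_diff_Suc)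
    then have j: "j = i + Suc d" "0 < pos j" using 2 by auto
    have "(resolvent z * J) $$ (i, j) = 1 / q ^ Suc (Suc d) * (z - q) + 1 / q ^ Suc d"
      using step ij j 2 pos_pred[of j] ev_pred[of j] q by (auto simp: resolvent_def simp flip: q_def)
    also have "\<dots> = z * (1 / q ^ Suc (Suc d))" using q by (simp add: field_simps)
    finally show ?thesis using 2 d ij by (simp add: resolvent_def q_def)
  next
    case 3
    then have "\<not> (i \<le> j - 1 \<and> j - 1 - i \<le> pos j - 1)" if "0 < pos j"
      using that pos_le[OF ij(2)] by linarith
    moreover have "i \<noteq> j" using 3 by auto
    ultimately show ?thesis using 3 step ij pos_pred[of j] by (auto simp: resolvent_def)
  qed
qed (use J_carrier in \<open>auto simp: resolvent_def\<close>)

text \<open>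
  The formula for \<open>resolvent z * J\<close> exhibits a left inverse of \<open>zI - J\<close>; as the matrices are square, it is
  a right inverse as well, which is what is needed for solving \<open>(zI - J) s = y\<close>.
\<close>

lemma J_mult_resolvent_vec:
  assumes z: "\<And>j. j < N \<Longrightarrow> z \<noteq> ev j" and y: "y \<in> carrier_vec N"
  shows "J *\<^sub>v (resolvent z *\<^sub>v y) = z \<cdot>\<^sub>v (resolvent z *\<^sub>v y) - y"
proof -
  let ?S = "resolvent z" and ?zJ = "z \<cdot>\<^sub>m 1\<^sub>m N - J"
  have zJ: "?zJ \<in> carrier_mat N N" using J_carrier by auto
  have "?S * ?zJ = ?S * (z \<cdot>\<^sub>m 1\<^sub>m N) - ?S * J"
    using J_carrier resolvent_carrier by (intro mult_minus_distrib_mat) auto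
  also have "?S * (z \<cdot>\<^sub>m 1\<^sub>m N) = z \<cdot>\<^sub>m ?S"
    using resolvent_carrier[of z] by (simp add: mult_smult_distrib[of _ N N _ N])
  also have "z \<cdot>\<^sub>m ?S - ?S * J = 1\<^sub>m N"
    using resolvent_mult_J[of z] z resolvent_carrier[of z] by (intro eq_matI) auto
  finally have "?zJ * ?S = 1\<^sub>m N"
    by (rule mat_mult_left_right_inverse[OF resolvent_carrier zJ])
  then have "?zJ *\<^sub>v (?S *\<^sub>v y) = y"
    using assoc_mult_mat_vec[OF zJ resolvent_carrier[of z] y] y by simp
  moreover have Sy: "?S *\<^sub>v y \<in> carrier_vec N"
    by (rule mult_mat_vec_carrier[OF resolvent_carrier y])
  moreover have "?zJ *\<^sub>v s = z \<cdot>\<^sub>v s - J *\<^sub>v s" if "s \<in> carrier_vec N" for s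
    using that J_carrier by (subst minus_mult_distrib_mat_vec[of _ N N]) 
      (auto simp: smult_mat_mult_vec)
  ultimately have "z \<cdot>\<^sub>v (?S *\<^sub>v y) - J *\<^sub>v (?S *\<^sub>v y) = y" by simp
  then show ?thesis using Sy y J_carrier by (auto simp: vec_eq_iff algebra_simps)
qed

text \<open>
  Since \<open>J\<close> is upper triangular, \<open>J - ev d\<close> maps vectors that vanish beyond position \<open>d\<close> to vectors that
  vanish from position \<open>d\<close> on. Applying these maps for decreasing \<open>d\<close> to a nonzero \<open>v\<close> must produce \<open>0\<close>
  at some step, and the last nonzero vector before it is an eigenvector.
\<close>

lemma eigenvector_in_invariant_subset:
  assumes V: "V \<subseteq> carrier_vec N" and closed: "\<And>v a. v \<in> V \<Longrightarrow> J *\<^sub>v v - a \<cdot>\<^sub>v v \<in> V"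
    and v: "v \<in> V" "v \<noteq> 0\<^sub>v N"
  obtains u \<mu> where "u \<in> V" "u \<noteq> 0\<^sub>v N" "J *\<^sub>v u = \<mu> \<cdot>\<^sub>v u"
proof -
  have "\<exists>u\<in>V. \<exists>\<mu>. u \<noteq> 0\<^sub>v N \<and> J *\<^sub>v u = \<mu> \<cdot>\<^sub>v u"
    if "v \<in> V" "v \<noteq> 0\<^sub>v N" "\<And>i. d \<le> i \<Longrightarrow> i < N \<Longrightarrow> v $ i = 0" for v d
    using that
  proof (induction d arbitrary: v)
    case 0
    then show ?case using V by (auto simp: vec_eq_iff)
  next
    case (Suc d)
    have v: "v \<in> carrier_vec N" using Suc.prems V by auto
    define u where "u = J *\<^sub>v v - ev d \<cdot>\<^sub>v v"
    have "u $ i = 0" if "d \<le> i" "i < N" for i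
      using that Suc.prems(3)[of i] Suc.prems(3)[of "Suc i"] v J_carrier
      by (cases "i = d") (auto simp: u_def J_mult_vec_index simp del: index_mult_mat_vec)
    then show ?case
    proof (cases "u = 0\<^sub>v N")
      case True
      then have "J *\<^sub>v v = ev d \<cdot>\<^sub>v v" using v J_carrier by (auto simp: u_def vec_eq_iff)
      then show ?thesis using Suc.prems by auto
    next
      case False
      then show ?thesis
        using Suc.IH[of u] closed[OF Suc.prems(1)] \<open>\<And>i. d \<le> i \<Longrightarrow> i < N \<Longrightarrow> u $ i = 0\<close> by (auto simp: u_def)
    qed
  qed
  from this[of v N] show ?thesis using v that by auto
qed

text \<open>
  Row \<open>i\<close> of the eigenvalue equation determines \<open>u $ i\<close> from \<open>u $ (i + 1)\<close> in a block with another eigenvalue,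
  so that \<open>u\<close> vanishes there, from the last position of the block backwards. In a block for \<open>\<mu>\<close> it says
  directly that \<open>u $ (i + 1)\<close> is \<open>0\<close>.
\<close>

lemma eigenvector_support:
  assumes u: "u \<in> carrier_vec N" and eig: "J *\<^sub>v u = \<mu> \<cdot>\<^sub>v u" and "i < N" "u $ i \<noteq> 0"
  shows "pos i = 0 \<and> ev i = \<mu>"
proof -
  have row: "ev i * u $ i + (if Suc i < N \<and> 0 < pos (Suc i) then u $ Suc i else 0) = \<mu> * u $ i"
    if "i < N" for i
    using J_mult_vec_index[OF u that] eig u that by simp
  have zero: "u $ i = 0" if "i < N" "ev i \<noteq> \<mu>" for i
    using that
  proof (induction "N - i" arbitrary: i rule: less_induct)
    case less
    have "(if Suc i < N \<and> 0 < pos (Suc i) then u $ Suc i else 0) = 0"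
      using less.hyps[of "Suc i"] less.prems ev_pred[of "Suc i"] by auto
    then show ?case using row[of i] less.prems by auto
  qed
  have "ev i = \<mu>" using zero assms by blast
  moreover have "pos i = 0"
  proof (rule ccontr)
    assume "pos i \<noteq> 0"
    then have "0 < i" using pos_le[OF \<open>i < N\<close>] by simp
    moreover from this have "i - 1 < N" using \<open>i < N\<close> by simp
    ultimately show False
      using row[of "i - 1"] ev_pred[of i] \<open>pos i \<noteq> 0\<close> assms \<open>ev i = \<mu>\<close> by auto
  qed
  ultimately show ?thesis by simp
qed

end

section \<open>The entries of a Jordan chain system, chain after chain\<close>

text \<open>
  The columns of \<open>X\<close> in order, each with the eigenvalue of its chain and its position in the chain,
  counted from \<open>0\<close>.
\<close>

definition chain_entries :: "(complex \<times> complex vec list) list \<Rightarrow> (complex \<times> nat \<times> complex vec) list" where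
  "chain_entries cs = concat (map (\<lambda>(l, xs). map (\<lambda>s. (l, s, xs ! s)) [0..<length xs]) cs)"

definition entry_eigenvalue :: "(complex \<times> complex vec list) list \<Rightarrow> nat \<Rightarrow> complex" where
  "entry_eigenvalue cs j = fst (chain_entries cs ! j)"
definition entry_position :: "(complex \<times> complex vec list) list \<Rightarrow> nat \<Rightarrow> nat" where
  "entry_position cs j = fst (snd (chain_entries cs ! j))"
definition entry_vec :: "(complex \<times> complex vec list) list \<Rightarrow> nat \<Rightarrow> complex vec" where
  "entry_vec cs j = snd (snd (chain_entries cs ! j))"

lemma chain_entries_Nil [simp]: "chain_entries [] = []"
  by (simp add: chain_entries_def)

lemma chain_entries_Cons [simp]:
  "chain_entries ((l, xs) # cs) = map (\<lambda>s. (l, s, xs ! s)) [0..<length xs] @ chain_entries cs"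
  by (simp add: chain_entries_def)

lemma chain_entries_append:
  "chain_entries (cs @ cs') = chain_entries cs @ chain_entries cs'"
  by (simp add: chain_entries_def)

lemma length_chain_entries: "length (chain_entries cs) = (\<Sum>c\<leftarrow>cs. length (snd c))"
  by (induction cs) auto

lemma concat_chains: "concat (map snd cs) = map (snd \<circ> snd) (chain_entries cs)"
  by (induction cs) (auto simp: comp_def map_nth)

lemma entry_position_0: "chain_entries cs \<noteq> [] \<Longrightarrow> entry_position cs 0 = 0"
  unfolding entry_position_def by (induction cs) (auto simp: nth_append)

lemma sum_list_jordan_blocks: "sum_list (map fst (jordan_blocks cs)) = length (chain_entries cs)"
  by (simp add: jordan_blocks_def length_chain_entries comp_def case_prod_beta)

text \<open>
  The superdiagonal has a zero exactly where a new block starts, that is, in the columns of position \<open>0\<close>.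
\<close>

lemma jordan_matrix_chain_entries_index:
  assumes "i < length (chain_entries cs)" "j < length (chain_entries cs)"
  shows "jordan_matrix (jordan_blocks cs) $$ (i, j) =
    (if i = j then entry_eigenvalue cs j else if Suc i = j \<and> 0 < entry_position cs j then 1 else 0)"
  using assms
proof (induction cs arbitrary: i j)
  case (Cons c cs)
  obtain l xs where c: "c = (l, xs)" by force
  let ?k = "length xs" and ?N = "length (chain_entries cs)"
  have dim: "sum_list (map fst (jordan_blocks cs)) = ?N" by (rule sum_list_jordan_blocks)
  have J: "jordan_matrix (jordan_blocks (c # cs)) = four_block_mat (jordan_block ?k l) (0\<^sub>m ?k ?N)
      (0\<^sub>m ?N ?k) (jordan_matrix (jordan_blocks cs))"
    using jordan_matrix_Cons[of ?k l "jordan_blocks cs"] dim by (simp add: jordan_blocks_def c)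
  have ij: "i < ?k + ?N" "j < ?k + ?N" using Cons.prems c by auto
  have shift: "entry_eigenvalue (c # cs) j = entry_eigenvalue cs (j - ?k)" "entry_position (c # cs) j = entry_position cs (j - ?k)"
    if "?k \<le> j" using that by (auto simp: entry_eigenvalue_def entry_position_def c nth_append)
  have first: "entry_eigenvalue (c # cs) j = l" "entry_position (c # cs) j = j" if "j < ?k"
    using that by (auto simp: entry_eigenvalue_def entry_position_def c nth_append)
  consider "i < ?k" "j < ?k" | "i < ?k" "?k \<le> j" | "?k \<le> i" "j < ?k" | "?k \<le> i" "?k \<le> j" by linarith
  then show ?case
  proof cases
    case 1
    then show ?thesis using ij first by (auto simp: J jordan_block_def)
  next
    case 2
    have "entry_position cs 0 = 0" using 2 ij by (intro entry_position_0) auto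
    then have "\<not> (Suc i = j \<and> 0 < entry_position cs (j - ?k))"
      using 2 by (metis Suc_leI diff_self_eq_0 le_antisym less_irrefl)
    then show ?thesis using 2 ij shift dim by (auto simp: J)
  next
    case 3
    then show ?thesis using ij dim by (auto simp: J)
  next
    case 4
    then have "Suc (i - ?k) = j - ?k \<longleftrightarrow> Suc i = j" "i - ?k = j - ?k \<longleftrightarrow> i = j" by auto
    then show ?thesis using 4 ij shift dim Cons.IH[of "i - ?k" "j - ?k"] by (auto simp: J)
  qed
qed simp

text \<open>
  The chain through column \<open>j\<close> is laid out contiguously; all further facts about its block are
  read off from this.
\<close>

lemma chain_entries_block:
  assumes "j < length (chain_entries cs)"
  shows "entry_position cs j \<le> j \<and> (\<exists>xs. (entry_eigenvalue cs j, xs) \<in> set cs \<and> entry_position cs j < length xs \<and>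
    (\<forall>i<length xs. j - entry_position cs j + i < length (chain_entries cs) \<and>
       chain_entries cs ! (j - entry_position cs j + i) = (entry_eigenvalue cs j, i, xs ! i)))"
  using assms
proof (induction cs arbitrary: j)
  case (Cons c cs)
  obtain l xs where c: "c = (l, xs)" by force
  show ?case
  proof (cases "j < length xs")
    case True
    then show ?thesis
      by (auto simp: c entry_eigenvalue_def entry_position_def nth_append intro!: exI[of _ xs])
  next
    case False
    let ?j = "j - length xs"
    have eq: "entry_eigenvalue (c # cs) j = entry_eigenvalue cs ?j" "entry_position (c # cs) j = entry_position cs ?j"
      using False by (auto simp: entry_eigenvalue_def entry_position_def c nth_append)
    have "?j < length (chain_entries cs)" using Cons.prems False c by auto
    from Cons.IH[OF this] obtain ys where ys: "entry_position cs ?j \<le> ?j" "(entry_eigenvalue cs ?j, ys) \<in> set cs"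
      "entry_position cs ?j < length ys"
      "\<And>i. i < length ys \<Longrightarrow> ?j - entry_position cs ?j + i < length (chain_entries cs) \<and>
       chain_entries cs ! (?j - entry_position cs ?j + i) = (entry_eigenvalue cs ?j, i, ys ! i)" by blast
    have shift: "j - entry_position cs ?j + i = length xs + (?j - entry_position cs ?j + i)" for i
      using ys(1) False by linarith
    have "\<forall>i<length ys. j - entry_position cs ?j + i < length (chain_entries (c # cs)) \<and>
       chain_entries (c # cs) ! (j - entry_position cs ?j + i) = (entry_eigenvalue cs ?j, i, ys ! i)"
      unfolding shift using ys(4) by (auto simp: c nth_append)
    then show ?thesis unfolding eq using ys(1-3) False by (intro conjI exI[of _ ys]) auto
  qed
qed simp

lemma jordan_shift_chain_entries:
  "jordan_shift (length (chain_entries cs)) (jordan_matrix (jordan_blocks cs)) (entry_eigenvalue cs) (entry_position cs)"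
proof
  fix j assume j: "j < length (chain_entries cs)"
  show "entry_position cs j \<le> j" using chain_entries_block[OF j] by simp
  assume p: "0 < entry_position cs j"
  have j1: "j - entry_position cs j + (entry_position cs j - 1) = j - 1"
    using p chain_entries_block[OF j] by linarith
  obtain xs where "chain_entries cs ! (j - 1) = (entry_eigenvalue cs j, entry_position cs j - 1, xs)"
    using chain_entries_block[OF j] p j1 by (metis less_imp_diff_less)
  then show "entry_position cs (j - 1) = entry_position cs j - 1" "entry_eigenvalue cs (j - 1) = entry_eigenvalue cs j"
    by (simp_all add: entry_eigenvalue_def entry_position_def)
qed (use jordan_matrix_carrier[of "jordan_blocks cs"] jordan_matrix_chain_entries_index
      in \<open>simp_all add: sum_list_jordan_blocks\<close>)

lemma mat_of_chains_index:
  assumes "i < n" "j < length (chain_entries cs)"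
  shows "mat_of_cols n (concat (map snd cs)) $$ (i, j) = entry_vec cs j $ i"
  using assms by (simp add: concat_chains mat_of_cols_index entry_vec_def)

text \<open>
  Both sides list the eigenvectors for \<open>l\<close>; the left one is the list in the definition of a Jordan chain
  system, the right one selects columns of \<open>X\<close>.
\<close>

lemma chain_heads_eq:
  assumes "\<And>c. c \<in> set cs \<Longrightarrow> snd c \<noteq> []"
  shows "map hd (map snd (filter (\<lambda>c. fst c = l) cs)) =
    map (entry_vec cs) (filter (\<lambda>j. entry_eigenvalue cs j = l \<and> entry_position cs j = 0) [0..<length (chain_entries cs)])"
proof -
  have "map hd (map snd (filter (\<lambda>c. fst c = l) cs)) =
      map (snd \<circ> snd) (filter (\<lambda>(e, s, x). e = l \<and> s = 0) (chain_entries cs))"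
    using assms
  proof (induction cs)
    case (Cons c cs)
    obtain e xs where c: "c = (e, xs)" by force
    then obtain k where k: "length xs = Suc k" using Cons.prems[of c] by (cases xs) auto
    have "map (snd \<circ> snd) (filter (\<lambda>(e, s, x). e = l \<and> s = 0) (map (\<lambda>s. (e, s, xs ! s)) [0..<length xs]))
        = (if e = l then [hd xs] else [])"
      using k hd_conv_nth[of xs] length_greater_0_conv[of xs] by (auto simp: k upt_conv_Cons filter_empty_conv simp del: upt_Suc)
    then show ?case using Cons by (cases "e = l") (auto simp: c)
  qed simp
  also have "filter (\<lambda>(e, s, x). e = l \<and> s = 0) (chain_entries cs) =
      filter (\<lambda>(e, s, x). e = l \<and> s = 0) (map ((!) (chain_entries cs)) [0..<length (chain_entries cs)])"
    by (simp add: map_nth)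
  also have "\<dots> = map ((!) (chain_entries cs))
      (filter (\<lambda>j. entry_eigenvalue cs j = l \<and> entry_position cs j = 0) [0..<length (chain_entries cs)])"
    by (simp add: filter_map comp_def entry_eigenvalue_def entry_position_def case_prod_beta)
  finally show ?thesis by (simp add: comp_def entry_vec_def)
qed

section \<open>Jordan chains in coordinates\<close>

lemma higher_pderiv_monom_binomial:
  "(pderiv ^^ s) (monom c k) = monom (fact s * of_nat (k choose s) * (c :: complex)) (k - s)"
proof (induction s)
  case (Suc s)
  have "Suc s * (k choose Suc s) = (k - s) * (k choose s)"
    by (simp only: binomial_absorption binomial_absorb_comp)
  then have "of_nat (Suc s) * of_nat (k choose Suc s) = (of_nat (k - s) * of_nat (k choose s) :: complex)"
    by (metis of_nat_mult)
  note eq = this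
  have "fact (Suc s) * of_nat (k choose Suc s) * c = fact s * (of_nat (Suc s) * of_nat (k choose Suc s)) * c"
    by (simp only: fact_Suc mult_ac)
  also have "\<dots> = of_nat (k - s) * (fact s * of_nat (k choose s) * c)"
    unfolding eq by (simp only: mult_ac)
  finally have coeff: "fact (Suc s) * of_nat (k choose Suc s) * c
      = of_nat (k - s) * (fact s * of_nat (k choose s) * c)" .
  have "(pderiv ^^ Suc s) (monom c k) = pderiv (monom (fact s * of_nat (k choose s) * c) (k - s))"
    using Suc by simp
  also have "\<dots> = monom (of_nat (k - s) * (fact s * of_nat (k choose s) * c)) (k - s - 1)"
    by (rule pderiv_monom)
  finally show ?case unfolding coeff by simp
qed simp

lemma mat_poly_deriv_index:
  assumes "i < n" "j < n"
  shows "mat_poly_deriv n m A s z $$ (i, j)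
    = fact s * (\<Sum>k\<le>m. A k $$ (i, j) * of_nat (k choose s) * z ^ (k - s))"
  using assms by (simp add: mat_poly_deriv_def mat_poly_def higher_pderiv_sum
      higher_pderiv_monom_binomial poly_sum poly_monom sum_distrib_left mult_ac)

text \<open>
  The chain equation of index \<open>t + 1\<close>, with the derivatives of \<open>P\<close> at \<open>l\<close> expanded into the coefficients
  \<open>A k\<close>; the factorials cancel and leave binomial coefficients, the same as in the powers of a Jordan block.
\<close>

lemma jordan_chain_index:
  assumes chain: "jordan_chain n m A l xs" and "t < length xs" "i < n"
  shows "(\<Sum>s\<le>t. \<Sum>k\<le>m. \<Sum>a<n. A k $$ (i, a) * (of_nat (k choose s) * l ^ (k - s)) * xs ! (t - s) $ a) = 0"
proof -
  let ?f = "\<lambda>j. (1 / fact (j - 1)) \<cdot>\<^sub>v (mat_poly_deriv n m A (j - 1) l *\<^sub>v (xs ! (Suc t - j)))"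
  have xs: "xs ! (t - s) \<in> carrier_vec n" for s
    using chain \<open>t < length xs\<close> by (auto simp: jordan_chain_def subset_iff)
  have "finsum_vec TYPE(complex) n ?f {1..Suc t} = 0\<^sub>v n"
    using chain \<open>t < length xs\<close> unfolding jordan_chain_def
    by (elim conjE) (erule bspec, simp)
  then have "0 = finsum_vec TYPE(complex) n ?f {1..Suc t} $ i" using \<open>i < n\<close> by simp
  also have "\<dots> = (\<Sum>j\<in>{1..Suc t}. ?f j $ i)"
  proof (rule index_finsum_vec)
    have "xs ! (Suc t - j) \<in> carrier_vec n" if "1 \<le> j" for j
    proof -
      have "t - (j - 1) = Suc t - j" using that by simp
      then show ?thesis using xs[of "j - 1"] by metis
    qed
    note xs' = this
    have D: "mat_poly_deriv n m A s l \<in> carrier_mat n n" for s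
      by (simp add: mat_poly_deriv_def mat_poly_def)
    show "?f \<in> {1..Suc t} \<rightarrow> carrier_vec n"
    proof (rule Pi_I)
      fix j assume "j \<in> {1..Suc t}"
      then have "1 \<le> j" by simp
      show "?f j \<in> carrier_vec n"
        unfolding smult_carrier_vec using D xs'[OF \<open>1 \<le> j\<close>] by (rule mult_mat_vec_carrier)
    qed
  qed (use \<open>i < n\<close> in auto)
  also have "\<dots> = (\<Sum>s\<in>{0..t}. ?f (Suc s) $ i)"
    using sum.shift_bounds_cl_Suc_ivl[of "\<lambda>j. ?f j $ i" 0 t] by simp
  also have "\<dots> = (\<Sum>s\<le>t. \<Sum>k\<le>m. \<Sum>a<n. A k $$ (i, a) * (of_nat (k choose s) * l ^ (k - s)) * xs ! (t - s) $ a)"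
  proof (rule sum.cong)
    fix s
    have D: "mat_poly_deriv n m A s l \<in> carrier_mat n n" by (simp add: mat_poly_deriv_def mat_poly_def)
    have "?f (Suc s) $ i = 1 / fact s * (\<Sum>a<n. mat_poly_deriv n m A s l $$ (i, a) * xs ! (t - s) $ a)"
      using D mult_mat_vec_index_sum[OF D xs[of s] \<open>i < n\<close>] \<open>i < n\<close> by (simp del: index_mult_mat_vec)
    also have "\<dots> = (\<Sum>a<n. (\<Sum>k\<le>m. A k $$ (i, a) * of_nat (k choose s) * l ^ (k - s)) * xs ! (t - s) $ a)"
      unfolding sum_distrib_left[of "1 / fact s"] using \<open>i < n\<close>
      by (intro sum.cong refl) (simp add: mat_poly_deriv_index)
    also have "\<dots> = (\<Sum>k\<le>m. \<Sum>a<n. A k $$ (i, a) * (of_nat (k choose s) * l ^ (k - s)) * xs ! (t - s) $ a)"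
      unfolding sum_distrib_right mult.assoc by (rule sum.swap)
    finally show "?f (Suc s) $ i
        = (\<Sum>k\<le>m. \<Sum>a<n. A k $$ (i, a) * (of_nat (k choose s) * l ^ (k - s)) * xs ! (t - s) $ a)" .
  qed auto
  finally show ?thesis by simp
qed

section \<open>The total length of a Jordan chain system\<close>

text \<open>
  A factor need not attain the degree bound, so \<open>coeff (f i) m\<close> may be \<open>0\<close>. At the extreme degree only the extreme
  coefficients of the factors contribute to the convolution.
\<close>

lemma coeff_prod_sum_bounds:
  fixes f :: "'a \<Rightarrow> 'b :: comm_semiring_1 poly"
  assumes "finite S" "\<And>i. i \<in> S \<Longrightarrow> degree (f i) \<le> m"
  shows "degree (prod f S) \<le> card S * m \<and> coeff (prod f S) (card S * m) = (\<Prod>i\<in>S. coeff (f i) m)"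
  using assms
proof (induction S)
  case (insert i S)
  let ?p = "f i" and ?q = "prod f S"
  have IH: "degree ?q \<le> card S * m" "coeff ?q (card S * m) = (\<Prod>i\<in>S. coeff (f i) m)" "degree ?p \<le> m"
    using insert by auto
  have "degree (?p * ?q) \<le> m + card S * m"
    using degree_mult_le[of ?p ?q] IH by linarith
  moreover have "coeff (?p * ?q) (m + card S * m) = coeff ?p m * coeff ?q (card S * m)"
  proof -
    have "coeff (?p * ?q) (m + card S * m)
        = (\<Sum>j\<le>m + card S * m. coeff ?p j * coeff ?q (m + card S * m - j))"
      by (rule coeff_mult)
    also have "\<dots> = (\<Sum>j\<le>m + card S * m. if j = m then coeff ?p m * coeff ?q (card S * m) else 0)"
    proof (rule sum.cong)
      fix j assume "j \<in> {..m + card S * m}"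
      show "coeff ?p j * coeff ?q (m + card S * m - j) = (if j = m then coeff ?p m * coeff ?q (card S * m) else 0)"
      proof (cases j m rule: linorder_cases)
        case less
        then have "degree ?q < m + card S * m - j" using IH by linarith
        then show ?thesis using less by (simp add: coeff_eq_0)
      next
        case greater
        then show ?thesis using IH by (simp add: coeff_eq_0)
      qed simp
    qed simp
    also have "\<dots> = coeff ?p m * coeff ?q (card S * m)" by simp
    finally show ?thesis .
  qed
  ultimately show ?case using insert IH by simp
qed simp

lemma coeff_signof_mult: "coeff (signof p * q) k = signof p * coeff (q :: complex poly) k"
  by (cases "sign p = 1") (auto simp: sign_def)

text \<open>
  In the Leibniz expansion each product consists of \<open>n\<close> factors of degree at most \<open>m\<close>, so the coefficient of
  degree \<open>n m\<close> of the determinant is the determinant of the leading coefficient.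
\<close>

lemma degree_det_mat_poly:
  assumes "A m \<in> carrier_mat n n" "Determinant.det (A m) \<noteq> 0"
  shows "degree (Determinant.det (mat_poly n m A)) = n * m"
proof -
  let ?M = "mat_poly n m A"
  have entry: "degree (?M $$ (i, j)) \<le> m" "coeff (?M $$ (i, j)) m = A m $$ (i, j)" if "i < n" "j < n" for i j
    using that by (auto simp: mat_poly_def coeff_sum intro!: degree_sum_le order_trans[OF degree_monom_le])
  have det: "Determinant.det ?M = (\<Sum>p | p permutes {0..<n}. signof p * (\<Prod>i = 0..<n. ?M $$ (i, p i)))"
    by (simp add: Determinant.det_def mat_poly_def)
  have prod: "degree (\<Prod>i = 0..<n. ?M $$ (i, p i)) \<le> n * m"
    "coeff (\<Prod>i = 0..<n. ?M $$ (i, p i)) (n * m) = (\<Prod>i = 0..<n. A m $$ (i, p i))"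
    if "p permutes {0..<n}" for p
  proof -
    have "p i < n" if "i < n" for i using permutes_in_image[OF \<open>p permutes {0..<n}\<close>, of i] that by simp
    then show "degree (\<Prod>i = 0..<n. ?M $$ (i, p i)) \<le> n * m"
      "coeff (\<Prod>i = 0..<n. ?M $$ (i, p i)) (n * m) = (\<Prod>i = 0..<n. A m $$ (i, p i))"
      using coeff_prod_sum_bounds[of "{0..<n}" "\<lambda>i. ?M $$ (i, p i)" m] entry by auto
  qed
  have "Determinant.det (A m) = (\<Sum>p | p permutes {0..<n}. signof p * (\<Prod>i = 0..<n. A m $$ (i, p i)))"
    using assms(1) by (simp add: Determinant.det_def)
  then have "coeff (Determinant.det ?M) (n * m) = Determinant.det (A m)"
    using prod by (simp add: det coeff_sum coeff_signof_mult)
  moreover have "degree (Determinant.det ?M) \<le> n * m"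
    unfolding det
  proof (rule degree_sum_le)
    fix p assume "p \<in> {p. p permutes {0..<n}}"
    then show "degree (signof p * (\<Prod>i = 0..<n. ?M $$ (i, p i))) \<le> n * m"
      using prod[of p] by (cases "sign p = 1") (auto simp: sign_def)
  qed (simp add: finite_permutations)
  ultimately show ?thesis using assms(2) le_degree[of "Determinant.det ?M" "n * m"] by simp
qed

lemma poly_det_mat_poly:
  "poly (Determinant.det (mat_poly n m A)) z = Determinant.det (mat_poly_eval n m A z)"
proof -
  have "comm_ring_hom (\<lambda>p :: complex poly. poly p z)" by unfold_locales auto
  then show ?thesis using comm_ring_hom.hom_det[of "\<lambda>p. poly p z" "mat_poly n m A"] by (simp add: mat_poly_eval_def)
qed

lemma sum_order_complex_poly:
  assumes "(p :: complex poly) \<noteq> 0"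
  shows "(\<Sum>z | poly p z = 0. order z p) = degree p"
proof -
  have "degree p = size (proots p)" by (simp add: size_proots_complex)
  then show ?thesis using assms by (simp add: size_multiset_overloaded_eq)
qed

lemma sum_list_group_by:
  fixes f :: "'a \<Rightarrow> nat"
  assumes "finite S" "g ` set cs \<subseteq> S"
  shows "sum_list (map f cs) = (\<Sum>l\<in>S. sum_list (map f (filter (\<lambda>c. g c = l) cs)))"
  using assms(2)
proof (induction cs)
  case (Cons c cs)
  have "(\<Sum>l\<in>S. sum_list (map f (filter (\<lambda>c. g c = l) (c # cs))))
      = (\<Sum>l\<in>S. (if l = g c then f c else 0) + sum_list (map f (filter (\<lambda>c. g c = l) cs)))"
    by (intro sum.cong) auto
  then show ?case using Cons assms(1) by (simp add: sum.distrib)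
qed simp

text \<open>
  The chains for an eigenvalue have total length equal to its multiplicity as a root of \<open>det P\<close>, and over
  the complex numbers these multiplicities add up to the degree.
\<close>

lemma length_chain_entries_jordan_chain_system:
  assumes "jordan_chain_system n m A cs" "A m \<in> carrier_mat n n" "Determinant.det (A m) \<noteq> 0"
  shows "length (chain_entries cs) = n * m"
proof -
  let ?d = "Determinant.det (mat_poly n m A)"
  \<comment> \<open>If \<open>n m = 0\<close>, the degree does not exclude the zero polynomial.\<close>
  have "?d \<noteq> 0"
  proof
    assume d0: "?d = 0"
    then have "n = 0 \<or> m = 0" using degree_det_mat_poly[of A m n] assms by simp
    then show False
    proof
      assume "n = 0"
      then show False using d0 by (simp add: mat_poly_def)
    next
      assume "m = 0"
      have "mat_poly_eval n 0 A 0 = A 0" using assms(2) \<open>m = 0\<close> by (intro eq_matI) (auto simp: mat_poly_eval_index)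
      then show False using assms(3) d0 \<open>m = 0\<close> poly_det_mat_poly[of n 0 A 0] by simp
    qed
  qed
  have ev: "{l. is_eigenvalue n m A l} = {l. poly ?d l = 0}"
    by (simp add: is_eigenvalue_def poly_det_mat_poly)
  have "fst ` set cs \<subseteq> {l. is_eigenvalue n m A l}"
    using assms(1) by (auto simp: jordan_chain_system_def)
  then have "length (chain_entries cs)
      = (\<Sum>l | is_eigenvalue n m A l. sum_list (map (\<lambda>c. length (snd c)) (filter (\<lambda>c. fst c = l) cs)))"
    unfolding length_chain_entries
    by (intro sum_list_group_by) (use poly_roots_finite[OF \<open>?d \<noteq> 0\<close>] ev in auto)
  also have "\<dots> = (\<Sum>l | is_eigenvalue n m A l. order l ?d)"
    using assms(1) by (intro sum.cong refl)
      (auto simp: jordan_chain_system_def Let_def alg_mult_def comp_def)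
  also have "\<dots> = degree ?d" using sum_order_complex_poly[OF \<open>?d \<noteq> 0\<close>] ev by simp
  finally show ?thesis using degree_det_mat_poly[of A m n] assms by simp
qed

section \<open>The inverse of a matrix polynomial from a Jordan triple\<close>

lemma block_index_less:
  fixes k m a n :: nat
  assumes "k < m" "a < n"
  shows "k * n + a < n * m"
proof -
  have "Suc k * n \<le> m * n" using assms by (intro mult_le_mono1) simp
  then show ?thesis using assms by (simp add: mult.commute)
qed

lemma mult_mat_vec_zero:
  "M \<in> carrier_mat nr nc \<Longrightarrow> M *\<^sub>v 0\<^sub>v nc = (0\<^sub>v nr :: complex vec)"
  by (intro eq_vecI) (auto simp: scalar_prod_def)

lemma the_mat_inverse:
  fixes M :: "complex mat"
  assumes M: "M \<in> carrier_mat k k" and det: "Determinant.det M \<noteq> 0"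
  shows "the (mat_inverse M) \<in> carrier_mat k k"
    "M * the (mat_inverse M) = 1\<^sub>m k" "the (mat_inverse M) * M = 1\<^sub>m k"
proof -
  have "mat_inverse M \<noteq> None"
    using mat_inverse(1)[OF M, where b = "()"] det_non_zero_imp_unit[OF M det, of "()"] by blast
  then obtain B where "mat_inverse M = Some B" by blast
  then show "the (mat_inverse M) \<in> carrier_mat k k"
    "M * the (mat_inverse M) = 1\<^sub>m k" "the (mat_inverse M) * M = 1\<^sub>m k"
    using mat_inverse(2)[OF M] by auto
qed

locale regular_jordan_system =
  fixes n m :: nat and A :: "nat \<Rightarrow> complex mat" and cs :: "(complex \<times> complex vec list) list"
    and X J Y :: "complex mat"
  assumes m_pos: "1 \<le> m"
    and A_carrier: "\<And>j. j \<le> m \<Longrightarrow> A j \<in> carrier_mat n n"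
    and det_lead: "Determinant.det (A m) \<noteq> 0"
    and triple: "jordan_triple n m A cs X J Y"
begin

definition A_inv where "A_inv = the (mat_inverse (A m))"

lemma system: "jordan_chain_system n m A cs"
  and X_eq: "X = mat_of_cols n (concat (map snd cs))"
  and J_eq: "J = jordan_matrix (jordan_blocks cs)"
  and Y_eq: "Y = the (mat_inverse (stacked_mat n m X J)) * (0\<^sub>m (n * (m - 1)) n @\<^sub>r A_inv)"
  using triple by (simp_all add: jordan_triple_def A_inv_def)

lemma length_entries: "length (chain_entries cs) = n * m"
  using length_chain_entries_jordan_chain_system[OF system] A_carrier det_lead by simp

sublocale jordan_shift "n * m" J "entry_eigenvalue cs" "entry_position cs"
  using jordan_shift_chain_entries[of cs] by (simp add: length_entries J_eq)

lemma jordan_chain_of: "(l, xs) \<in> set cs \<Longrightarrow> jordan_chain n m A l xs"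
  using system by (auto simp: jordan_chain_system_def maximal_jordan_chain_def)

lemma X_carrier: "X \<in> carrier_mat n (n * m)"
  using mat_of_cols_carrier(1)[of n "map (snd \<circ> snd) (chain_entries cs)"]
  unfolding X_eq concat_chains by (simp only: length_map length_entries)

lemma X_index: "i < n \<Longrightarrow> j < n * m \<Longrightarrow> X $$ (i, j) = entry_vec cs j $ i"
  unfolding X_eq by (rule mat_of_chains_index) (simp_all add: length_entries)

lemma pow_J_carrier: "J ^\<^sub>m k \<in> carrier_mat (n * m) (n * m)"
  by (rule pow_carrier_mat[OF J_carrier])

lemma X_pow_J_index:
  assumes "a < n" "j < n * m"
  shows "(X * J ^\<^sub>m k) $$ (a, j) = (\<Sum>s\<le>entry_position cs j.
    of_nat (k choose s) * entry_eigenvalue cs j ^ (k - s) * entry_vec cs (j - s) $ a)"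
proof -
  let ?p = "entry_position cs j"
  have "(X * J ^\<^sub>m k) $$ (a, j) = (\<Sum>b<n * m. X $$ (a, b) * (J ^\<^sub>m k) $$ (b, j))"
    using assms X_carrier pow_J_carrier by (intro mult_mat_index_sum)
  also have "\<dots> = (\<Sum>b\<in>(\<lambda>s. j - s) ` {..?p}. X $$ (a, b) * (J ^\<^sub>m k) $$ (b, j))"
  proof (rule sum.mono_neutral_right)
    show "\<forall>b\<in>{..<n * m} - (\<lambda>s. j - s) ` {..?p}. X $$ (a, b) * (J ^\<^sub>m k) $$ (b, j) = 0"
    proof
      fix b assume b: "b \<in> {..<n * m} - (\<lambda>s. j - s) ` {..?p}"
      have "\<not> (b \<le> j \<and> j - b \<le> ?p)"
      proof
        assume "b \<le> j \<and> j - b \<le> ?p"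
        then have "b = j - (j - b)" "j - b \<in> {..?p}" by simp_all
        then show False using b by blast
      qed
      then have "(J ^\<^sub>m k) $$ (b, j) = 0" using pow_J_index[of b j k] assms b by auto
      then show "X $$ (a, b) * (J ^\<^sub>m k) $$ (b, j) = 0" by simp
    qed
  qed (use assms in auto)
  also have "\<dots> = (\<Sum>s\<le>?p. X $$ (a, j - s) * (J ^\<^sub>m k) $$ (j - s, j))"
    using pos_le[OF assms(2)] by (subst sum.reindex) (auto simp: inj_on_def)
  also have "\<dots> = (\<Sum>s\<le>?p. of_nat (k choose s) * entry_eigenvalue cs j ^ (k - s) * entry_vec cs (j - s) $ a)"
  proof (rule sum.cong)
    fix s assume "s \<in> {..?p}"
    then have "s \<le> ?p" "j - (j - s) = s" using pos_le[OF assms(2)] by auto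
    then show "X $$ (a, j - s) * (J ^\<^sub>m k) $$ (j - s, j)
        = of_nat (k choose s) * entry_eigenvalue cs j ^ (k - s) * entry_vec cs (j - s) $ a"
      using assms X_index[of a "j - s"] pow_J_index[of "j - s" j k] by simp
  qed simp
  finally show ?thesis .
qed

text \<open>
  Column by column, \<open>\<Sum>\<^sub>k A\<^sub>k X J\<^bsup>k\<^esup> = 0\<close> is the system of Jordan chain equations: column \<open>j\<close> collects the
  binomial coefficients that come from the powers of the block, and these are the ones that come from
  the derivatives of \<open>P\<close>.
\<close>

lemma sum_A_X_pow_J_eq_0:
  assumes "i < n" "j < n * m"
  shows "(\<Sum>k\<le>m. (A k * (X * J ^\<^sub>m k)) $$ (i, j)) = 0"
proof -
  let ?p = "entry_position cs j" and ?l = "entry_eigenvalue cs j"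
  have "j < length (chain_entries cs)" using assms length_entries by simp
  from chain_entries_block[OF this] obtain xs where xs: "(?l, xs) \<in> set cs" "?p < length xs"
    "\<And>t. t < length xs \<Longrightarrow> chain_entries cs ! (j - ?p + t) = (?l, t, xs ! t)"
    by blast
  have vec: "entry_vec cs (j - s) = xs ! (?p - s)" if "s \<le> ?p" for s
  proof -
    have "j - ?p + (?p - s) = j - s" using that pos_le[OF assms(2)] by simp
    then show ?thesis using xs(3)[of "?p - s"] xs(2) by (simp add: entry_vec_def)
  qed
  have "(A k * (X * J ^\<^sub>m k)) $$ (i, j)
      = (\<Sum>s\<le>?p. \<Sum>a<n. A k $$ (i, a) * (of_nat (k choose s) * ?l ^ (k - s)) * xs ! (?p - s) $ a)"
    if "k \<le> m" for k
  proof -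
    have "(A k * (X * J ^\<^sub>m k)) $$ (i, j) = (\<Sum>a<n. A k $$ (i, a) * (X * J ^\<^sub>m k) $$ (a, j))"
      using assms A_carrier[OF that] X_carrier pow_J_carrier
      by (intro mult_mat_index_sum mult_carrier_mat)
    also have "\<dots> = (\<Sum>a<n. \<Sum>s\<le>?p. A k $$ (i, a) * (of_nat (k choose s) * ?l ^ (k - s)) * xs ! (?p - s) $ a)"
    proof (rule sum.cong)
      fix a assume "a \<in> {..<n}"
      then have "(X * J ^\<^sub>m k) $$ (a, j)
          = (\<Sum>s\<le>?p. of_nat (k choose s) * ?l ^ (k - s) * entry_vec cs (j - s) $ a)"
        using X_pow_J_index assms(2) by blast
      also have "\<dots> = (\<Sum>s\<le>?p. of_nat (k choose s) * ?l ^ (k - s) * xs ! (?p - s) $ a)"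
        by (intro sum.cong refl) (simp only: vec atMost_iff)
      finally show "A k $$ (i, a) * (X * J ^\<^sub>m k) $$ (a, j)
          = (\<Sum>s\<le>?p. A k $$ (i, a) * (of_nat (k choose s) * ?l ^ (k - s)) * xs ! (?p - s) $ a)"
        by (simp only: sum_distrib_left mult.assoc)
    qed simp
    finally show ?thesis by (rule trans[OF _ sum.swap])
  qed
  then have "(\<Sum>k\<le>m. (A k * (X * J ^\<^sub>m k)) $$ (i, j))
      = (\<Sum>k\<le>m. \<Sum>s\<le>?p. \<Sum>a<n. A k $$ (i, a) * (of_nat (k choose s) * ?l ^ (k - s)) * xs ! (?p - s) $ a)"
    by (intro sum.cong refl) (simp only: atMost_iff)
  also have "\<dots> = (\<Sum>s\<le>?p. \<Sum>k\<le>m. \<Sum>a<n. A k $$ (i, a) * (of_nat (k choose s) * ?l ^ (k - s)) * xs ! (?p - s) $ a)"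
    by (rule sum.swap)
  also have "\<dots> = 0"
    using jordan_chain_index[OF jordan_chain_of[OF xs(1)] xs(2) assms(1)] by simp
  finally show ?thesis .
qed

text \<open>
  For \<open>k < m\<close> this is the \<open>k\<close>-th block of the product of the stacked matrix with \<open>v\<close>. Working with vectors avoids sums of
  matrices.
\<close>

definition XJ :: "nat \<Rightarrow> complex vec \<Rightarrow> complex vec" where
  "XJ k v = X *\<^sub>v (J ^\<^sub>m k *\<^sub>v v)"

lemma XJ_carrier [simp]: "XJ k v \<in> carrier_vec n"
  by (rule carrier_vecI) (simp add: XJ_def carrier_matD(1)[OF X_carrier])

lemma XJ_eq_mult: "v \<in> carrier_vec (n * m) \<Longrightarrow> XJ k v = (X * J ^\<^sub>m k) *\<^sub>v v"
  unfolding XJ_def by (rule assoc_mult_mat_vec[OF X_carrier pow_J_carrier, symmetric])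

lemma XJ_Suc:
  assumes "v \<in> carrier_vec (n * m)"
  shows "XJ (Suc k) v = XJ k (J *\<^sub>v v)"
  unfolding XJ_def using assoc_mult_mat_vec[OF pow_J_carrier J_carrier assms] by simp

lemma XJ_linear:
  assumes "v \<in> carrier_vec (n * m)" "u \<in> carrier_vec (n * m)"
  shows "XJ k (v - u) = XJ k v - XJ k u" "XJ k (a \<cdot>\<^sub>v v) = a \<cdot>\<^sub>v XJ k v"
proof -
  have XJk: "X * J ^\<^sub>m k \<in> carrier_mat n (n * m)" using X_carrier pow_J_carrier by (rule mult_carrier_mat)
  show "XJ k (v - u) = XJ k v - XJ k u"
    using assms mult_minus_distrib_mat_vec[OF XJk] by (simp add: XJ_eq_mult)
  show "XJ k (a \<cdot>\<^sub>v v) = a \<cdot>\<^sub>v XJ k v"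
    using assms mult_mat_vec[OF XJk] by (simp add: XJ_eq_mult)
qed

lemma sum_A_XJ_eq_0:
  assumes v: "v \<in> carrier_vec (n * m)" and "i < n"
  shows "(\<Sum>k\<le>m. (A k *\<^sub>v XJ k v) $ i) = 0"
proof -
  have "(A k *\<^sub>v XJ k v) $ i = (\<Sum>j<n * m. (A k * (X * J ^\<^sub>m k)) $$ (i, j) * v $ j)" if "k \<le> m" for k
  proof -
    have XJk: "X * J ^\<^sub>m k \<in> carrier_mat n (n * m)" using X_carrier pow_J_carrier by (rule mult_carrier_mat)
    have "A k *\<^sub>v XJ k v = (A k * (X * J ^\<^sub>m k)) *\<^sub>v v"
      using assoc_mult_mat_vec[OF A_carrier[OF that] XJk v] v by (simp add: XJ_eq_mult)
    moreover have "A k * (X * J ^\<^sub>m k) \<in> carrier_mat n (n * m)"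
      using A_carrier[OF that] XJk by (rule mult_carrier_mat)
    then have "((A k * (X * J ^\<^sub>m k)) *\<^sub>v v) $ i = (\<Sum>j<n * m. (A k * (X * J ^\<^sub>m k)) $$ (i, j) * v $ j)"
      using v \<open>i < n\<close> by (intro mult_mat_vec_index_sum)
    ultimately show ?thesis by simp
  qed
  then have "(\<Sum>k\<le>m. (A k *\<^sub>v XJ k v) $ i)
      = (\<Sum>k\<le>m. \<Sum>j<n * m. (A k * (X * J ^\<^sub>m k)) $$ (i, j) * v $ j)"
    by (intro sum.cong refl) (simp only: atMost_iff)
  also have "\<dots> = (\<Sum>j<n * m. (\<Sum>k\<le>m. (A k * (X * J ^\<^sub>m k)) $$ (i, j)) * v $ j)"
    unfolding sum_distrib_right by (rule sum.swap)
  finally have "(\<Sum>k\<le>m. (A k *\<^sub>v XJ k v) $ i)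
      = (\<Sum>j<n * m. (\<Sum>k\<le>m. (A k * (X * J ^\<^sub>m k)) $$ (i, j)) * v $ j)" .
  then show ?thesis using sum_A_X_pow_J_eq_0[OF \<open>i < n\<close>] by (simp del: index_mult_mat)
qed

lemma A_inv: "A_inv \<in> carrier_mat n n" "A m * A_inv = 1\<^sub>m n" "A_inv * A m = 1\<^sub>m n"
  unfolding A_inv_def by (rule the_mat_inverse[OF A_carrier[OF order_refl] det_lead])+

text \<open>
  As \<open>A\<^sub>m\<close> is invertible, \<open>\<Sum>\<^sub>k A\<^sub>k X J\<^bsup>k\<^esup> = 0\<close> expresses \<open>X J\<^bsup>m\<^esup>\<close> through the lower powers. So the common kernel of
  the first \<open>m\<close> blocks is invariant under \<open>J\<close>.
\<close>

lemma XJ_eq_0_all: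
  assumes v: "v \<in> carrier_vec (n * m)" and zero: "\<And>k. k < m \<Longrightarrow> XJ k v = 0\<^sub>v n"
  shows "XJ k v = 0\<^sub>v n"
proof -
  have main: "\<forall>k<m. XJ k v = 0\<^sub>v n \<Longrightarrow> v \<in> carrier_vec (n * m) \<Longrightarrow> XJ k v = 0\<^sub>v n" for v k
  proof (induction k arbitrary: v)
    case 0
    then show ?case using m_pos by simp
  next
    case (Suc k)
    have Jv: "J *\<^sub>v v \<in> carrier_vec (n * m)" using mult_mat_vec_carrier[OF J_carrier Suc.prems(2)] .
    have Am: "A m \<in> carrier_mat n n" using A_carrier by simp
    have "A m *\<^sub>v XJ m v = 0\<^sub>v n"
    proof (rule eq_vecI)
      fix i assume "i < dim_vec (0\<^sub>v n :: complex vec)"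
      then have "i < n" by simp
      have "(\<Sum>k<m. (A k *\<^sub>v XJ k v) $ i) = (\<Sum>k<m. 0)"
      proof (rule sum.cong)
        fix k assume k: "k \<in> {..<m}"
        then have "A k \<in> carrier_mat n n" using A_carrier by simp
        then show "(A k *\<^sub>v XJ k v) $ i = 0" using Suc.prems(1) k \<open>i < n\<close> by simp
      qed simp
      moreover have "(\<Sum>k\<le>m. (A k *\<^sub>v XJ k v) $ i)
          = (\<Sum>k<m. (A k *\<^sub>v XJ k v) $ i) + (A m *\<^sub>v XJ m v) $ i"
        by (simp add: lessThan_Suc_atMost[symmetric])
      ultimately show "(A m *\<^sub>v XJ m v) $ i = 0\<^sub>v n $ i"
        using sum_A_XJ_eq_0[OF Suc.prems(2) \<open>i < n\<close>] \<open>i < n\<close> by simp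
    qed (use Am in simp)
    moreover have "A_inv *\<^sub>v 0\<^sub>v n = 0\<^sub>v n"
      using A_inv(1) by (rule mult_mat_vec_zero)
    ultimately have "A_inv *\<^sub>v (A m *\<^sub>v XJ m v) = 0\<^sub>v n" by simp
    then have top: "XJ m v = 0\<^sub>v n"
      using A_inv assoc_mult_mat_vec[OF A_inv(1) Am XJ_carrier] by simp
    have "\<forall>k<m. XJ k (J *\<^sub>v v) = 0\<^sub>v n"
    proof (intro allI impI)
      fix k assume "k < m"
      then show "XJ k (J *\<^sub>v v) = 0\<^sub>v n"
        using Suc.prems top XJ_Suc[OF Suc.prems(2), of k] by (cases "Suc k = m") auto
    qed
    then show ?case using Suc.IH[OF _ Jv] XJ_Suc[OF Suc.prems(2)] by simp
  qed
  show ?thesis by (rule main) (use assms in simp_all)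
qed

text \<open>
  By \<open>eigenvector_support\<close>, \<open>X u\<close> is a linear combination of the first vectors of the chains for \<open>\<mu>\<close>, which are linearly independent.
\<close>

lemma eigenvector_kernel:
  assumes u: "u \<in> carrier_vec (n * m)" and eig: "J *\<^sub>v u = \<mu> \<cdot>\<^sub>v u" and X0: "X *\<^sub>v u = 0\<^sub>v n"
  shows "u = 0\<^sub>v (n * m)"
proof (rule ccontr)
  assume "u \<noteq> 0\<^sub>v (n * m)"
  then obtain i\<^sub>0 where i0: "i\<^sub>0 < n * m" "u $ i\<^sub>0 \<noteq> 0" using u by (auto simp: vec_eq_iff)
  define I where "I = filter (\<lambda>j. entry_eigenvalue cs j = \<mu> \<and> entry_position cs j = 0) [0..<n * m]"
  define es where "es = map (entry_vec cs) I"
  have supp: "i \<in> set I" if "i < n * m" "u $ i \<noteq> 0" for i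
    using eigenvector_support[OF u eig that] that by (simp add: I_def)
  have I: "distinct I" "set I \<subseteq> {..<n * m}" by (auto simp: I_def)
  have "is_eigenvalue n m A \<mu>"
  proof -
    have "entry_eigenvalue cs i\<^sub>0 = \<mu>" using supp[OF i0] by (simp add: I_def)
    then show ?thesis
      using chain_entries_block[of i\<^sub>0 cs] i0 length_entries system
      unfolding jordan_chain_system_def by fastforce
  qed
  then have heads: "distinct (map hd (map snd (filter (\<lambda>c. fst c = \<mu>) cs)))"
    "\<not> LinearCombinations.module.lin_dep class_ring (module_vec TYPE(complex) n)
       (set (map hd (map snd (filter (\<lambda>c. fst c = \<mu>) cs))))"
    using system unfolding jordan_chain_system_def Let_def by blast+
  have "snd c \<noteq> []" if "c \<in> set cs" for c
    using jordan_chain_of[of "fst c" "snd c"] that by (simp add: jordan_chain_def)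
  then have "map hd (map snd (filter (\<lambda>c. fst c = \<mu>) cs)) = es"
    unfolding es_def I_def length_entries[symmetric] by (rule chain_heads_eq)
  note heads = heads[unfolded this]
  have es_carrier: "set es \<subseteq> carrier_vec n"
  proof
    fix x assume "x \<in> set es"
    then obtain j where j: "j < n * m" "x = entry_vec cs j" using I by (auto simp: es_def)
    have "entry_vec cs j \<in> set (map (snd \<circ> snd) (chain_entries cs))"
      using j length_entries by (auto simp: entry_vec_def)
    then have "entry_vec cs j \<in> set (concat (map snd cs))" by (simp only: concat_chains)
    then show "x \<in> carrier_vec n" using j jordan_chain_of by (fastforce simp: jordan_chain_def)
  qed
  define c where "c = vec (length I) (\<lambda>k. u $ (I ! k))"
  have "mat_of_cols n es *\<^sub>v c = 0\<^sub>v n"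
  proof (rule eq_vecI)
    fix i assume "i < dim_vec (0\<^sub>v n :: complex vec)"
    then have i: "i < n" by simp
    have "(mat_of_cols n es *\<^sub>v c) $ i = (\<Sum>k<length I. entry_vec cs (I ! k) $ i * u $ (I ! k))"
      using i mult_mat_vec_index_sum[OF mat_of_cols_carrier(1), of c es i n]
      by (simp add: c_def es_def mat_of_cols_index del: index_mult_mat_vec)
    also have "\<dots> = (\<Sum>j\<in>set I. entry_vec cs j $ i * u $ j)"
      using sum_list_sum_nth[of "map (\<lambda>j. entry_vec cs j $ i * u $ j) I"] I(1)
      by (simp add: sum_list_distinct_conv_sum_set atLeast0LessThan)
    also have "\<dots> = (\<Sum>j<n * m. entry_vec cs j $ i * u $ j)"
      using I(2) supp by (intro sum.mono_neutral_left) auto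
    also have "\<dots> = (X *\<^sub>v u) $ i"
      using i by (simp add: mult_mat_vec_index_sum[OF X_carrier u i] X_index del: index_mult_mat_vec)
    finally show "(mat_of_cols n es *\<^sub>v c) $ i = 0\<^sub>v n $ i" using X0 by simp
  qed simp
  moreover have "c \<noteq> 0\<^sub>v (length es)"
  proof -
    obtain k where "k < length I" "I ! k = i\<^sub>0" using supp[OF i0] by (metis in_set_conv_nth)
    then have "c $ k \<noteq> 0" "k < length es" using i0 by (auto simp: c_def es_def)
    then show ?thesis by auto
  qed
  moreover have "c \<in> carrier_vec (length es)" by (simp add: c_def es_def)
  ultimately show False
    using vec_space.lin_depI[of "mat_of_cols n es" n "length es" c] heads es_carrier by simp
qed

text \<open>
  A nonzero \<open>J\<close>-invariant kernel would contain an eigenvector of \<open>J\<close>.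
\<close>

lemma trivial_common_kernel:
  assumes v: "v \<in> carrier_vec (n * m)" and zero: "\<And>k. k < m \<Longrightarrow> XJ k v = 0\<^sub>v n"
  shows "v = 0\<^sub>v (n * m)"
proof (rule ccontr)
  assume "v \<noteq> 0\<^sub>v (n * m)"
  let ?V = "{v \<in> carrier_vec (n * m). \<forall>k. XJ k v = 0\<^sub>v n}"
  have "J *\<^sub>v u - a \<cdot>\<^sub>v u \<in> ?V" if "u \<in> ?V" for u a
  proof -
    have "J *\<^sub>v u \<in> carrier_vec (n * m)" using that mult_mat_vec_carrier[OF J_carrier] by blast
    then show ?thesis using that XJ_Suc[of u] XJ_linear[of "J *\<^sub>v u" "a \<cdot>\<^sub>v u"]
      XJ_linear(2)[of u u] by auto
  qed
  moreover have "v \<in> ?V" using v XJ_eq_0_all[OF v zero] by simp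
  ultimately obtain u \<mu> where u: "u \<in> ?V" "u \<noteq> 0\<^sub>v (n * m)" "J *\<^sub>v u = \<mu> \<cdot>\<^sub>v u"
    using eigenvector_in_invariant_subset[of ?V v] \<open>v \<noteq> 0\<^sub>v (n * m)\<close> by blast
  have "XJ 0 u = X *\<^sub>v u" using u J_carrier by (simp add: XJ_def)
  then show False using u eigenvector_kernel[of u \<mu>] by auto
qed

lemma stacked_carrier: "stacked_mat n m X J \<in> carrier_mat (n * m) (n * m)"
  by (simp add: stacked_mat_def)

lemma stacked_mult_vec_index:
  assumes v: "v \<in> carrier_vec (n * m)" and "k < m" "a < n"
  shows "(stacked_mat n m X J *\<^sub>v v) $ (k * n + a) = XJ k v $ a"
proof -
  have "k * n + a < n * m"
    using assms by (simp add: block_index_less)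
  moreover from this have "stacked_mat n m X J $$ (k * n + a, j) = (X * J ^\<^sub>m k) $$ (a, j)"
    if "j < n * m" for j
    using that \<open>a < n\<close> by (simp add: stacked_mat_def)
  moreover have "X * J ^\<^sub>m k \<in> carrier_mat n (n * m)"
    using X_carrier pow_J_carrier by (rule mult_carrier_mat)
  ultimately show ?thesis
    using mult_mat_vec_index_sum[OF stacked_carrier v, of "k * n + a"]
      mult_mat_vec_index_sum[of "X * J ^\<^sub>m k" n "n * m" v a] v \<open>a < n\<close> XJ_eq_mult[OF v, of k]
    by (simp del: index_mult_mat_vec index_mult_mat)
qed

lemma stacked_inverse:
  "the (mat_inverse (stacked_mat n m X J)) \<in> carrier_mat (n * m) (n * m)"
  "stacked_mat n m X J * the (mat_inverse (stacked_mat n m X J)) = 1\<^sub>m (n * m)"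
proof -
  let ?Q = "stacked_mat n m X J"
  have det: "Determinant.det ?Q \<noteq> 0"
  proof
    assume "Determinant.det ?Q = 0"
    then obtain v where v: "v \<in> carrier_vec (n * m)" "v \<noteq> 0\<^sub>v (n * m)" "?Q *\<^sub>v v = 0\<^sub>v (n * m)"
      using det_0_iff_vec_prod_zero[OF stacked_carrier] by auto
    have "XJ k v = 0\<^sub>v n" if "k < m" for k
    proof (rule eq_vecI)
      fix a assume "a < dim_vec (0\<^sub>v n :: complex vec)"
      then have a: "a < n" by simp
      have "k * n + a < n * m" using that a by (simp add: block_index_less)
      then show "XJ k v $ a = 0\<^sub>v n $ a"
        using stacked_mult_vec_index[OF v(1) that a] v(3) a by simp
    qed (simp add: carrier_vecD[OF XJ_carrier])
    then show False using trivial_common_kernel[OF v(1)] v(2) by blast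
  qed
  show "the (mat_inverse ?Q) \<in> carrier_mat (n * m) (n * m)" "?Q * the (mat_inverse ?Q) = 1\<^sub>m (n * m)"
    by (rule the_mat_inverse[OF stacked_carrier det])+
qed

lemma rhs_carrier: "0\<^sub>m (n * (m - 1)) n @\<^sub>r A_inv \<in> carrier_mat (n * m) n"
proof -
  have "n * (m - 1) + n = n * m" using m_pos by (cases m) auto
  then show ?thesis
    using carrier_append_rows[OF zero_carrier_mat[of "n * (m - 1)" n] A_inv(1)] by simp
qed

lemma Y_carrier: "Y \<in> carrier_mat (n * m) n"
  unfolding Y_eq using stacked_inverse(1) rhs_carrier by (rule mult_carrier_mat)

text \<open>
  The defining property of \<open>Y\<close>, read off block by block from \<open>Q Y = (0, \<dots>, 0, A\<^sub>m\<inverse>)\<close> for the stacked matrix \<open>Q\<close>.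
\<close>

lemma XJ_Y:
  assumes u: "u \<in> carrier_vec n" and "k < m"
  shows "XJ k (Y *\<^sub>v u) = (if Suc k = m then A_inv *\<^sub>v u else 0\<^sub>v n)"
proof (rule eq_vecI)
  let ?Q = "stacked_mat n m X J" and ?B = "0\<^sub>m (n * (m - 1)) n @\<^sub>r A_inv"
  fix a assume "a < dim_vec (if Suc k = m then A_inv *\<^sub>v u else 0\<^sub>v n)"
  then have a: "a < n" using A_inv by (auto split: if_splits)
  have Yu: "Y *\<^sub>v u \<in> carrier_vec (n * m)" using Y_carrier u by (rule mult_mat_vec_carrier)
  have "?Q * Y = ?B"
    unfolding Y_eq using assoc_mult_mat[OF stacked_carrier stacked_inverse(1) rhs_carrier]
      stacked_inverse(2) left_mult_one_mat[OF rhs_carrier] by simp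
  then have "?Q *\<^sub>v (Y *\<^sub>v u) = ?B *\<^sub>v u"
    using assoc_mult_mat_vec[OF stacked_carrier Y_carrier u] by simp
  then have "XJ k (Y *\<^sub>v u) $ a = (?B *\<^sub>v u) $ (k * n + a)"
    using stacked_mult_vec_index[OF Yu \<open>k < m\<close> a] by simp
  also have "\<dots> = (if Suc k = m then A_inv *\<^sub>v u else 0\<^sub>v n) $ a"
  proof (cases "Suc k = m")
    case True
    then have "k * n + a = n * (m - 1) + a" by auto
    moreover have "row ?B (n * (m - 1) + a) = row A_inv a"
      using a A_inv by (intro eq_vecI) (auto simp: append_rows_def)
    moreover have "n * (m - 1) + a < dim_row ?B" using a A_inv by (simp add: append_rows_def)
    ultimately have "(?B *\<^sub>v u) $ (k * n + a) = row A_inv a \<bullet> u"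
      by (simp only: index_mult_mat_vec)
    also have "\<dots> = (A_inv *\<^sub>v u) $ a" using a A_inv(1) by simp
    finally show ?thesis using True by simp
  next
    case False
    then have "Suc k \<le> m - 1" using \<open>k < m\<close> by linarith
    then have "Suc k * n \<le> (m - 1) * n" by (rule mult_le_mono1)
    then have lt: "k * n + a < n * (m - 1)" using a by (simp add: mult.commute)
    then have "k * n + a < dim_row ?B" by (simp add: append_rows_def)
    moreover have "row ?B (k * n + a) = 0\<^sub>v n"
      using a A_inv(1) lt by (intro eq_vecI) (auto simp: append_rows_def)
    ultimately have "(?B *\<^sub>v u) $ (k * n + a) = 0\<^sub>v n \<bullet> u"
      by (simp only: index_mult_mat_vec)
    then show ?thesis using False a u by simp
  qed
  finally show "XJ k (Y *\<^sub>v u) $ a = (if Suc k = m then A_inv *\<^sub>v u else 0\<^sub>v n) $ a" .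
qed (use A_inv(1) in \<open>simp add: carrier_vecD[OF XJ_carrier]\<close>)

definition mat_poly_inverse :: "complex \<Rightarrow> complex mat" where
  "mat_poly_inverse z = X * resolvent z * Y"

lemma mat_poly_inverse_carrier: "mat_poly_inverse z \<in> carrier_mat n n"
  unfolding mat_poly_inverse_def
  by (rule mult_carrier_mat[OF mult_carrier_mat[OF X_carrier resolvent_carrier] Y_carrier])

text \<open>
  With \<open>y = Y u\<close> and \<open>s = (zI - J)\<inverse> y\<close> the relation \<open>J s = z s - y\<close> gives inductively \<open>X J\<^bsup>k\<^esup> s = z\<^bsup>k\<^esup> X s\<close> for
  \<open>k < m\<close>, since \<open>X J\<^bsup>k\<^esup> y\<close> vanishes for \<open>k < m - 1\<close>. For \<open>k = m\<close> the correction \<open>A\<^sub>m\<inverse> u\<close> appears. Multiplying by the \<open>A\<^sub>k\<close>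
  and adding up yields \<open>0 = P(z) X s - u\<close>.
\<close>

lemma mat_poly_eval_mult_mat_poly_inverse_vec:
  assumes z: "\<And>j. j < n * m \<Longrightarrow> z \<noteq> entry_eigenvalue cs j" and u: "u \<in> carrier_vec n"
  shows "mat_poly_eval n m A z *\<^sub>v (mat_poly_inverse z *\<^sub>v u) = u"
proof -
  define y where "y = Y *\<^sub>v u"
  define s where "s = resolvent z *\<^sub>v y"
  have y: "y \<in> carrier_vec (n * m)" unfolding y_def using Y_carrier u by (rule mult_mat_vec_carrier)
  have s: "s \<in> carrier_vec (n * m)" unfolding s_def using resolvent_carrier y by (rule mult_mat_vec_carrier)
  have Js: "J *\<^sub>v s = z \<cdot>\<^sub>v s - y" unfolding s_def by (rule J_mult_resolvent_vec) (use z y in auto)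
  have Xs: "XJ 0 s = mat_poly_inverse z *\<^sub>v u"
  proof -
    have "XJ 0 s = X *\<^sub>v s" using s J_carrier by (simp add: XJ_def)
    also have "\<dots> = (X * resolvent z) *\<^sub>v y"
      unfolding s_def using assoc_mult_mat_vec[OF X_carrier resolvent_carrier[of z] y] by simp
    also have "\<dots> = mat_poly_inverse z *\<^sub>v u"
      unfolding y_def mat_poly_inverse_def
      using assoc_mult_mat_vec[OF mult_carrier_mat[OF X_carrier resolvent_carrier[of z]] Y_carrier u] by simp
    finally show ?thesis .
  qed
  have XJ_s: "XJ k s = z ^ k \<cdot>\<^sub>v XJ 0 s - (if k = m then A_inv *\<^sub>v u else 0\<^sub>v n)" if "k \<le> m" for k
    using that
  proof (induction k)
    case 0
    have "0 \<noteq> m" using m_pos by simp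
    then show ?case by (intro eq_vecI) (simp_all add: carrier_vecD[OF XJ_carrier])
  next
    case (Suc k)
    have "XJ (Suc k) s = XJ k (z \<cdot>\<^sub>v s - y)" using XJ_Suc[OF s] Js by simp
    also have "\<dots> = z \<cdot>\<^sub>v XJ k s - XJ k y"
      using s y XJ_linear(1)[of "z \<cdot>\<^sub>v s" y k] XJ_linear(2)[of s s k z] by simp
    finally show ?case
      using Suc XJ_Y[OF u, of k] by (simp add: y_def smult_smult_assoc)
  qed
  have Am: "A m \<in> carrier_mat n n" using A_carrier by simp
  have AmAu: "A m *\<^sub>v (A_inv *\<^sub>v u) = u"
    using assoc_mult_mat_vec[OF Am A_inv(1) u] A_inv(2) u by simp
  have "mat_poly_eval n m A z *\<^sub>v XJ 0 s = u"
  proof (rule eq_vecI)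
    fix i assume "i < dim_vec u"
    then have i: "i < n" using u by simp
    let ?x = "XJ 0 s"
    have x: "?x \<in> carrier_vec n" by simp
    have summand: "(A k *\<^sub>v XJ k s) $ i = z ^ k * (A k *\<^sub>v ?x) $ i - (if k = m then u $ i else 0)"
      if "k \<le> m" for k
    proof -
      have Ak: "A k \<in> carrier_mat n n" using A_carrier[OF that] .
      have "A k *\<^sub>v XJ k s = z ^ k \<cdot>\<^sub>v (A k *\<^sub>v ?x) - A k *\<^sub>v (if k = m then A_inv *\<^sub>v u else 0\<^sub>v n)"
        unfolding XJ_s[OF that] using A_inv(1) u x
        by (subst mult_minus_distrib_mat_vec[OF Ak]) (simp_all add: mult_mat_vec[OF Ak x])
      then show ?thesis
        using Ak AmAu i u by (cases "k = m") (simp_all add: mult_mat_vec_zero del: index_mult_mat_vec)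
    qed
    have "0 = (\<Sum>k\<le>m. (A k *\<^sub>v XJ k s) $ i)" using sum_A_XJ_eq_0[OF s i] by simp
    also have "\<dots> = (\<Sum>k\<le>m. z ^ k * (A k *\<^sub>v ?x) $ i) - u $ i"
      by (simp add: summand sum_subtractf del: index_mult_mat_vec)
    also have "(\<Sum>k\<le>m. z ^ k * (A k *\<^sub>v ?x) $ i) = (\<Sum>k\<le>m. \<Sum>a<n. A k $$ (i, a) * z ^ k * ?x $ a)"
    proof (rule sum.cong)
      fix k assume "k \<in> {..m}"
      then have "A k \<in> carrier_mat n n" using A_carrier by simp
      then show "z ^ k * (A k *\<^sub>v ?x) $ i = (\<Sum>a<n. A k $$ (i, a) * z ^ k * ?x $ a)"
        using mult_mat_vec_index_sum[of "A k" n n ?x i] i x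
        by (simp add: sum_distrib_left mult_ac del: index_mult_mat_vec)
    qed simp
    also have "\<dots> = (\<Sum>a<n. (\<Sum>k\<le>m. A k $$ (i, a) * z ^ k) * ?x $ a)"
      unfolding sum_distrib_right by (rule sum.swap)
    also have "\<dots> = (mat_poly_eval n m A z *\<^sub>v ?x) $ i"
      using mult_mat_vec_index_sum[OF mat_poly_eval_carrier[of n m A z] x i] i
      by (simp add: mat_poly_eval_index del: index_mult_mat_vec)
    finally show "(mat_poly_eval n m A z *\<^sub>v ?x) $ i = u $ i" by simp
  qed (use u in simp)
  then show ?thesis using Xs by simp
qed

lemma mat_poly_eval_mult_mat_poly_inverse:
  assumes z: "\<And>j. j < n * m \<Longrightarrow> z \<noteq> entry_eigenvalue cs j"
  shows "mat_poly_eval n m A z * mat_poly_inverse z = 1\<^sub>m n"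
proof (rule eq_matI)
  let ?P = "mat_poly_eval n m A z"
  fix i j assume "i < dim_row (1\<^sub>m n :: complex mat)" "j < dim_col (1\<^sub>m n :: complex mat)"
  then have ij: "i < n" "j < n" by auto
  have R: "mat_poly_inverse z \<in> carrier_mat n n" by (rule mat_poly_inverse_carrier)
  have "col (?P * mat_poly_inverse z) j = ?P *\<^sub>v col (mat_poly_inverse z) j"
    using ij R by (intro col_mult2) auto
  also have "col (mat_poly_inverse z) j = mat_poly_inverse z *\<^sub>v unit_vec n j"
    using ij R by (intro eq_vecI) auto
  also have "?P *\<^sub>v \<dots> = unit_vec n j"
    by (rule mat_poly_eval_mult_mat_poly_inverse_vec[OF z]) auto
  finally have "col (?P * mat_poly_inverse z) j $ i = unit_vec n j $ i" by simp
  then show "(?P * mat_poly_inverse z) $$ (i, j) = 1\<^sub>m n $$ (i, j)"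
    using ij R by simp
qed (simp_all add: carrier_matD[OF mat_poly_inverse_carrier])

end

section \<open>The leading term of the inverse at an eigenvalue\<close>

lemma chain_entries_uniform:
  assumes "\<And>c. c \<in> set cs \<Longrightarrow> fst c = l \<and> length (snd c) = p"
  shows "length (chain_entries cs) = p * length cs \<and>
    (\<forall>j < p * length cs. entry_eigenvalue cs j = l \<and> entry_position cs j = j mod p)"
  using assms
proof (induction cs)
  case (Cons c cs)
  obtain xs where c: "c = (l, xs)" "length xs = p"
    using Cons.prems[of c] by (cases c) auto
  have IH: "length (chain_entries cs) = p * length cs"
    "\<And>j. j < p * length cs \<Longrightarrow> entry_eigenvalue cs j = l \<and> entry_position cs j = j mod p"
    using Cons by auto
  have "entry_eigenvalue (c # cs) j = l \<and> entry_position (c # cs) j = j mod p" if "j < p * length (c # cs)" for j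
  proof (cases "j < p")
    case True
    then show ?thesis using c by (simp add: entry_eigenvalue_def entry_position_def nth_append)
  next
    case False
    have "entry_eigenvalue cs (j - p) = l \<and> entry_position cs (j - p) = (j - p) mod p"
      using that False by (intro IH(2)) auto
    then show ?thesis
      using False c by (simp add: entry_eigenvalue_def entry_position_def nth_append le_mod_geq)
  qed
  then show ?case using IH(1) c by auto
qed simp

text \<open>
  The blocks of maximal size for \<open>l\<close> fill the first \<open>p\<close> times \<open>num_max_blocks l cs\<close> positions, so their last
  positions are \<open>k p + p - 1\<close>. Later blocks for \<open>l\<close> are too short to have a position \<open>p - 1\<close>.
\<close>

lemma last_positions_of_max_blocks:
  assumes first: "max_blocks_first l cs" and p: "p = max_block_size l cs" "0 < p"
    and ne: "\<And>c. c \<in> set cs \<Longrightarrow> snd c \<noteq> []"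
  shows "{j. j < length (chain_entries cs) \<and> entry_eigenvalue cs j = l \<and> p \<le> Suc (entry_position cs j)}
    = (\<lambda>k. k * p + (p - 1)) ` {..<num_max_blocks l cs}" (is "?L = ?R")
    and "j < length (chain_entries cs) \<Longrightarrow> entry_eigenvalue cs j = l \<Longrightarrow> entry_position cs j < p"
proof -
  let ?\<kappa> = "num_max_blocks l cs"
  let ?P = "\<lambda>c. (length (snd c), fst c) = (p, l)"
  have blocks: "jordan_blocks cs = map (\<lambda>c. (length (snd c), fst c)) cs"
    by (simp add: jordan_blocks_def case_prod_beta)
  have fin: "finite {s. (s, l) \<in> set (jordan_blocks cs)}"
    by (rule finite_subset[of _ "fst ` set (jordan_blocks cs)"]) force+
  have len_le: "length xs \<le> p" if "(l, xs) \<in> set cs" for xs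
    unfolding p max_block_size_def using that blocks by (intro Max_ge fin) force
  show pos: "entry_position cs j < p" if "j < length (chain_entries cs)" "entry_eigenvalue cs j = l" for j
    using chain_entries_block[OF that(1)] that(2) len_le by fastforce
  have \<kappa>: "?\<kappa> = length (filter ?P cs)"
    by (simp add: num_max_blocks_def blocks filter_map comp_def p)
  have \<kappa>_le: "?\<kappa> \<le> length cs" by (simp add: \<kappa>)
  define T D where "T = take ?\<kappa> cs" and "D = drop ?\<kappa> cs"
  have cs: "cs = T @ D" and lenT: "length T = ?\<kappa>" using \<kappa>_le by (simp_all add: T_def D_def)
  have T: "?P c" if c: "c \<in> set T" for c
  proof -
    obtain k where "k < length T" "c = T ! k" using c by (auto simp: in_set_conv_nth)
    then have "k < ?\<kappa>" "c = cs ! k" using lenT by (simp_all add: T_def)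
    then show ?thesis using first \<kappa>_le by (auto simp: max_blocks_first_def blocks p)
  qed
  have "filter ?P T = T" using T by (simp add: filter_id_conv)
  then have "length (filter ?P cs) = length T + length (filter ?P D)" by (subst cs) simp
  then have D: "\<not> ?P c" if "c \<in> set D" for c
    using that \<kappa> lenT by (auto simp: filter_empty_conv)
  have T': "fst c = l \<and> length (snd c) = p" if "c \<in> set T" for c using T[OF that] by simp
  have len_T: "length (chain_entries T) = p * ?\<kappa>"
    using chain_entries_uniform[of T l p] T' lenT by simp
  have entry_T: "entry_eigenvalue cs j = l \<and> entry_position cs j = j mod p" if "j < p * ?\<kappa>" for j
  proof -
    have "entry_eigenvalue T j = l \<and> entry_position T j = j mod p"
      using chain_entries_uniform[of T l p] T' that lenT by simp
    then show ?thesis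
      using that len_T by (simp add: entry_eigenvalue_def entry_position_def cs chain_entries_append nth_append)
  qed
  have entry_D: "\<not> (entry_eigenvalue cs j = l \<and> p \<le> Suc (entry_position cs j))"
    if "p * ?\<kappa> \<le> j" "j < length (chain_entries cs)" for j
  proof
    let ?j = "j - p * ?\<kappa>"
    assume j: "entry_eigenvalue cs j = l \<and> p \<le> Suc (entry_position cs j)"
    have eq: "entry_eigenvalue cs j = entry_eigenvalue D ?j" "entry_position cs j = entry_position D ?j"
      using that len_T by (simp_all add: entry_eigenvalue_def entry_position_def cs chain_entries_append nth_append)
    have "?j < length (chain_entries D)" using that len_T by (simp add: cs chain_entries_append)
    then obtain xs where xs: "(l, xs) \<in> set D" "entry_position D ?j < length xs"
      using chain_entries_block[of ?j D] j eq by auto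
    then have "p \<le> length xs" using j eq by simp
    then have "length xs = p" using len_le[of xs] xs(1) cs by (metis UnCI le_antisym set_append)
    then show False using D xs(1) by fastforce
  qed
  show "?L = ?R"
  proof (intro equalityI subsetI)
    fix j assume "j \<in> ?L"
    then have j: "j < length (chain_entries cs)" "entry_eigenvalue cs j = l" "p \<le> Suc (entry_position cs j)" by auto
    have lt: "j < p * ?\<kappa>"
    proof (rule ccontr)
      assume "\<not> ?thesis"
      then have "p * ?\<kappa> \<le> j" by simp
      from entry_D[OF this j(1)] j show False by simp
    qed
    then have "j mod p = p - 1" using entry_T[OF lt] j pos[OF j(1,2)] by simp
    then have "j = (j div p) * p + (p - 1)" by (metis div_mult_mod_eq)
    moreover have "j div p < ?\<kappa>" using lt \<open>0 < p\<close> by (simp add: less_mult_imp_div_less mult.commute)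
    ultimately show "j \<in> ?R" by blast
  next
    fix j assume "j \<in> ?R"
    then obtain k where k: "k < ?\<kappa>" "j = k * p + (p - 1)" by blast
    have "j < p * ?\<kappa>" using block_index_less[of k ?\<kappa> "p - 1" p] k \<open>0 < p\<close> by simp
    moreover have "j mod p = p - 1" unfolding k(2) mod_mult_self3 using \<open>0 < p\<close> by simp
    moreover have "p * ?\<kappa> \<le> length (chain_entries cs)" using len_T by (simp add: cs chain_entries_append)
    ultimately show "j \<in> ?L" using entry_T[of j] by simp
  qed
qed

context regular_jordan_system
begin

lemma chain_nonempty: "c \<in> set cs \<Longrightarrow> snd c \<noteq> []"
  using jordan_chain_of[of "fst c" "snd c"] by (simp add: jordan_chain_def)

lemma mat_poly_inverse_index:
  assumes "a < n" "b < n"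
  shows "mat_poly_inverse z $$ (a, b) = (\<Sum>j<n * m. \<Sum>i<n * m. X $$ (a, i) * resolvent z $$ (i, j) * Y $$ (j, b))"
  unfolding mat_poly_inverse_def
  using mult_mat_index_sum[OF mult_carrier_mat[OF X_carrier resolvent_carrier[of z]] Y_carrier assms]
    mult_mat_index_sum[OF X_carrier resolvent_carrier[of z] assms(1)]
  by (simp add: sum_distrib_right del: index_mult_mat)

text \<open>
  Entry \<open>(i, j)\<close> of the resolvent has a pole at \<open>l\<close> of order at most \<open>p\<close>, and order \<open>p\<close> occurs only in the
  upper right corner of a block for \<open>l\<close> of size \<open>p\<close>.
\<close>

lemma tendsto_scaled_resolvent_entry:
  assumes p: "0 < p" "\<And>j. j < n * m \<Longrightarrow> entry_eigenvalue cs j = l \<Longrightarrow> entry_position cs j < p"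
    and ij: "i < n * m" "j < n * m"
  shows "((\<lambda>z. (z - l) ^ p * resolvent z $$ (i, j)) \<longlongrightarrow>
    (if entry_eigenvalue cs j = l \<and> p \<le> Suc (entry_position cs j) \<and> i = j - (p - 1) then 1 else 0)) (at l)"
proof (cases "i \<le> j \<and> j - i \<le> entry_position cs j")
  case False
  have not_last: "\<not> (entry_eigenvalue cs j = l \<and> p \<le> Suc (entry_position cs j) \<and> i = j - (p - 1))"
    using False p pos_le[OF ij(2)] by (metis diff_diff_cancel diff_le_self le_trans less_Suc_eq_le
      Suc_pred' le_antisym not_less_eq_eq Suc_leI)
  have "resolvent z $$ (i, j) = 0" for z
    unfolding resolvent_def index_mat(1)[OF ij] prod.case if_not_P[OF False] by (rule refl)
  then show ?thesis unfolding if_not_P[OF not_last] by simp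
next
  case True
  define d where "d = Suc (j - i)"
  have res: "resolvent z $$ (i, j) = 1 / (z - entry_eigenvalue cs j) ^ d" for z
    using True ij by (simp add: resolvent_def d_def)
  show ?thesis
  proof (cases "entry_eigenvalue cs j = l")
    case False
    have "((\<lambda>z. (z - l) ^ p * (1 / (z - entry_eigenvalue cs j) ^ d)) \<longlongrightarrow> (l - l) ^ p * (1 / (l - entry_eigenvalue cs j) ^ d)) (at l)"
      using False by (intro tendsto_intros) auto
    then show ?thesis using False p(1) by (simp add: res zero_power)
  next
    case ev: True
    then have "d \<le> p" using True p(2)[OF ij(2)] by (simp add: d_def)
    have "((\<lambda>z. (z - l) ^ (p - d)) \<longlongrightarrow> (l - l) ^ (p - d)) (at l)"
      by (intro tendsto_intros)
    moreover have "\<forall>\<^sub>F z in at l. (z - l) ^ p * resolvent z $$ (i, j) = (z - l) ^ (p - d)"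
      unfolding eventually_at_filter
    proof (intro always_eventually allI impI)
      fix z assume "z \<noteq> l"
      then show "(z - l) ^ p * resolvent z $$ (i, j) = (z - l) ^ (p - d)"
        using ev \<open>d \<le> p\<close> by (simp add: res power_diff)
    qed
    ultimately have "((\<lambda>z. (z - l) ^ p * resolvent z $$ (i, j)) \<longlongrightarrow> (l - l) ^ (p - d)) (at l)"
      by (simp add: tendsto_cong)
    moreover have "(l - l) ^ (p - d) = (if d = p then 1 else 0)" using \<open>d \<le> p\<close> by auto
    moreover have "d = p \<longleftrightarrow> p \<le> Suc (entry_position cs j) \<and> i = j - (p - 1)"
      using True p(1) \<open>d \<le> p\<close> pos_le[OF ij(2)] by (auto simp: d_def)
    ultimately show ?thesis using ev by simp
  qed
qed

text \<open>
  In the limit only the corner entries of the largest blocks for \<open>l\<close> survive. Each of them multiplies the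
  first column of its block in \<open>X\<close> with the last row of its block in \<open>Y\<close>, and these are the columns of
  \<open>hat_X\<close> and the rows of \<open>hat_Y\<close>.
\<close>

lemma tendsto_scaled_mat_poly_inverse:
  assumes first: "max_blocks_first l cs" and p: "p = max_block_size l cs" "0 < p"
    and ab: "a < n" "b < n"
  shows "((\<lambda>z. (z - l) ^ p * mat_poly_inverse z $$ (a, b)) \<longlongrightarrow> (hat_X n l cs X * hat_Y n l cs Y) $$ (a, b)) (at l)"
proof -
  let ?\<kappa> = "num_max_blocks l cs"
  note last = last_positions_of_max_blocks[OF first p chain_nonempty, unfolded length_entries]
  \<comment> \<open>the last positions of the largest blocks for \<open>l\<close>\<close>
  define M where "M = {j. j < n * m \<and> entry_eigenvalue cs j = l \<and> p \<le> Suc (entry_position cs j)}"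
  have M_eq: "M = (\<lambda>k. k * p + (p - 1)) ` {..<?\<kappa>}" unfolding M_def by (rule last(1))
  let ?c = "\<lambda>i j. if j \<in> M \<and> i = j - (p - 1) then 1 else 0 :: complex"
  have "((\<lambda>z. \<Sum>j<n * m. \<Sum>i<n * m. X $$ (a, i) * ((z - l) ^ p * resolvent z $$ (i, j)) * Y $$ (j, b))
      \<longlongrightarrow> (\<Sum>j<n * m. \<Sum>i<n * m. X $$ (a, i) * ?c i j * Y $$ (j, b))) (at l)"
  proof (intro tendsto_sum tendsto_mult tendsto_const)
    fix i j assume ij: "j \<in> {..<n * m}" "i \<in> {..<n * m}"
    then have "((\<lambda>z. (z - l) ^ p * resolvent z $$ (i, j)) \<longlongrightarrow>
        (if entry_eigenvalue cs j = l \<and> p \<le> Suc (entry_position cs j) \<and> i = j - (p - 1) then 1 else 0)) (at l)"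
      using last(2) by (intro tendsto_scaled_resolvent_entry p) auto
    then show "((\<lambda>z. (z - l) ^ p * resolvent z $$ (i, j)) \<longlongrightarrow> ?c i j) (at l)"
      using ij by (simp add: M_def conj_assoc)
  qed
  moreover have "(\<lambda>z. \<Sum>j<n * m. \<Sum>i<n * m. X $$ (a, i) * ((z - l) ^ p * resolvent z $$ (i, j)) * Y $$ (j, b))
      = (\<lambda>z. (z - l) ^ p * mat_poly_inverse z $$ (a, b))"
    unfolding mat_poly_inverse_index[OF ab] sum_distrib_left by (intro ext sum.cong refl) (simp only: mult_ac)
  moreover have "(\<Sum>j<n * m. \<Sum>i<n * m. X $$ (a, i) * ?c i j * Y $$ (j, b))
      = (hat_X n l cs X * hat_Y n l cs Y) $$ (a, b)"
  proof -
    have "(\<Sum>i<n * m. X $$ (a, i) * ?c i j * Y $$ (j, b))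
        = (if j \<in> M then X $$ (a, j - (p - 1)) * Y $$ (j, b) else 0)" if "j < n * m" for j
    proof -
      have "(\<Sum>i<n * m. X $$ (a, i) * ?c i j * Y $$ (j, b))
          = (\<Sum>i<n * m. if i = j - (p - 1) then if j \<in> M then X $$ (a, j - (p - 1)) * Y $$ (j, b) else 0 else 0)"
        by (intro sum.cong refl) simp
      moreover have "j - (p - 1) < n * m" using that by arith
      ultimately show ?thesis by simp
    qed
    then have "(\<Sum>j<n * m. \<Sum>i<n * m. X $$ (a, i) * ?c i j * Y $$ (j, b))
        = (\<Sum>j<n * m. if j \<in> M then X $$ (a, j - (p - 1)) * Y $$ (j, b) else 0)"
      by (intro sum.cong refl) (simp only: lessThan_iff)
    also have "\<dots> = (\<Sum>j\<in>M. X $$ (a, j - (p - 1)) * Y $$ (j, b))"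
      by (rule sum.mono_neutral_cong_right) (auto simp: M_def)
    also have "\<dots> = (\<Sum>j\<in>(\<lambda>k. k * p + (p - 1)) ` {..<?\<kappa>}. X $$ (a, j - (p - 1)) * Y $$ (j, b))"
      unfolding M_eq by (rule refl)
    also have "\<dots> = (\<Sum>k<?\<kappa>. X $$ (a, k * p) * Y $$ (k * p + (p - 1), b))"
    proof (subst sum.reindex)
      show "inj_on (\<lambda>k. k * p + (p - 1)) {..<?\<kappa>}"
        using \<open>0 < p\<close> by (intro inj_onI) (simp only: add_right_cancel mult_cancel2, simp)
    qed simp
    also have "\<dots> = (\<Sum>k<?\<kappa>. hat_X n l cs X $$ (a, k) * hat_Y n l cs Y $$ (k, b))"
      using ab \<open>0 < p\<close> by (intro sum.cong refl) (simp add: hat_X_def hat_Y_def Let_def p(1)[symmetric])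
    also have "\<dots> = (hat_X n l cs X * hat_Y n l cs Y) $$ (a, b)"
      using ab by (intro mult_mat_index_sum[symmetric]) (simp_all add: hat_X_def hat_Y_def Let_def)
    finally show ?thesis .
  qed
  ultimately show ?thesis by (simp only:)
qed

end

text \<open>
  An eigenvalue has at least one chain because its chains have positive total length.
\<close>

lemma max_block_size_pos:
  assumes "jordan_chain_system n m A cs" "multiple_eigenvalue n m A l"
  shows "0 < max_block_size l cs"
proof -
  let ?S = "{s. (s, l) \<in> set (jordan_blocks cs)}"
  have "sum_list (map length (map snd (filter (\<lambda>c. fst c = l) cs))) = alg_mult n m A l"
    using assms unfolding jordan_chain_system_def multiple_eigenvalue_def Let_def by blast
  then have "filter (\<lambda>c. fst c = l) cs \<noteq> []"
    using assms(2) by (auto simp: multiple_eigenvalue_def)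
  then obtain xs where xs: "(l, xs) \<in> set cs" by (auto simp: filter_empty_conv)
  then have "jordan_chain n m A l xs"
    using assms(1) by (auto simp: jordan_chain_system_def maximal_jordan_chain_def)
  then have "0 < length xs" by (simp add: jordan_chain_def)
  moreover have "finite ?S" by (rule finite_subset[of _ "fst ` set (jordan_blocks cs)"]) force+
  moreover have "length xs \<in> ?S" using xs by (force simp: jordan_blocks_def)
  ultimately show ?thesis
    unfolding max_block_size_def by (metis Max_ge less_le_trans)
qed

section \<open>Asymptotics of the pseudospectral component\<close>

theorem theorem2:
  fixes n m :: nat
    and A :: "nat \<Rightarrow> complex mat"
    and w :: "nat \<Rightarrow> real"
    and l\<^sub>0 :: complex
    and cs :: "(complex \<times> complex vec list) list"
    and X J Y :: "complex mat"
    and p\<^sub>0 :: nat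
  assumes "1 \<le> m"
    and "\<And>j. j \<le> m \<Longrightarrow> A j \<in> carrier_mat n n"
    and "Determinant.det (A m) \<noteq> 0"
    and "0 < w 0"
    and "\<And>j. j \<le> m \<Longrightarrow> 0 \<le> w j"
    and "multiple_eigenvalue n m A l\<^sub>0"
    and "jordan_triple n m A cs X J Y"
    and "max_blocks_first l\<^sub>0 cs"
    and "p\<^sub>0 = max_block_size l\<^sub>0 cs"
  shows "(\<lambda>\<epsilon>. hausdorff_distance
            (connected_component_set (pseudospectrum n m A w \<epsilon>) l\<^sub>0)
            (cball l\<^sub>0 ((hat_k n m w l\<^sub>0 cs X Y * \<epsilon>) powr (1 / real p\<^sub>0))))
         \<in> o[at_right 0](\<lambda>\<epsilon>. \<epsilon> powr (1 / real p\<^sub>0))"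
proof -
  interpret regular_jordan_system n m A cs X J Y
    by unfold_locales (use assms in auto)
  have p: "0 < p\<^sub>0" using max_block_size_pos[OF system assms(6)] assms(9) by simp
  let ?R = mat_poly_inverse and ?G = "hat_X n l\<^sub>0 cs X * hat_Y n l\<^sub>0 cs Y"
  define \<phi> where "\<phi> z = cmod (z - l\<^sub>0) ^ p\<^sub>0 * weight m w (cmod z) * spectral_norm (?R z)" for z
  have "((\<lambda>z. weight m w (cmod z) * spectral_norm ((z - l\<^sub>0) ^ p\<^sub>0 \<cdot>\<^sub>m ?R z)) \<longlongrightarrow>
      weight m w (cmod l\<^sub>0) * spectral_norm ?G) (at l\<^sub>0)"
  proof (intro tendsto_mult tendsto_spectral_norm)
    show "((\<lambda>z. weight m w (cmod z)) \<longlongrightarrow> weight m w (cmod l\<^sub>0)) (at l\<^sub>0)"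
      unfolding weight_def by (intro tendsto_intros)
    show "(z - l\<^sub>0) ^ p\<^sub>0 \<cdot>\<^sub>m ?R z \<in> carrier_mat n n" for z
      by (rule smult_carrier_mat[OF mat_poly_inverse_carrier])
    show "?G \<in> carrier_mat n n"
      by (rule mult_carrier_mat[of _ _ "num_max_blocks l\<^sub>0 cs"]) (simp_all add: hat_X_def hat_Y_def Let_def)
    fix a b assume ab: "a < n" "b < n"
    then have "((z - l\<^sub>0) ^ p\<^sub>0 \<cdot>\<^sub>m ?R z) $$ (a, b) = (z - l\<^sub>0) ^ p\<^sub>0 * ?R z $$ (a, b)" for z
      by (intro index_smult_mat) (simp_all add: carrier_matD[OF mat_poly_inverse_carrier])
    then show "((\<lambda>z. ((z - l\<^sub>0) ^ p\<^sub>0 \<cdot>\<^sub>m ?R z) $$ (a, b)) \<longlongrightarrow> ?G $$ (a, b)) (at l\<^sub>0)"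
      using tendsto_scaled_mat_poly_inverse[OF assms(8,9) p ab] by (simp only:)
  qed
  then have lim: "(\<phi> \<longlongrightarrow> hat_k n m w l\<^sub>0 cs X Y) (at l\<^sub>0)"
    unfolding \<phi>_def hat_k_def by (simp add: spectral_norm_smult norm_power mult_ac)
  have "\<forall>\<^sub>F z in at l\<^sub>0. \<forall>j\<in>{..<n * m}. z \<noteq> entry_eigenvalue cs j"
    by (intro eventually_ball_finite ballI eventually_neq_at_within) simp
  then have regular: "\<forall>\<^sub>F z in at l\<^sub>0. z \<noteq> l\<^sub>0 \<and> mat_poly_eval n m A z * ?R z = 1\<^sub>m n"
    unfolding eventually_at_filter
    by eventually_elim (auto intro!: mat_poly_eval_mult_mat_poly_inverse)
  show ?thesis
  proof (rule hausdorff_distance_component_smallo[OF p _ _ lim])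
    show "0 \<le> hat_k n m w l\<^sub>0 cs X Y"
      unfolding hat_k_def using weight_pos[of w m "cmod l\<^sub>0"] assms(4,5) spectral_norm_nonneg
      by (intro mult_nonneg_nonneg) (auto intro: less_imp_le)
    show "l\<^sub>0 \<in> pseudospectrum n m A w \<epsilon>" if "\<epsilon> > 0" for \<epsilon>
      using assms that by (intro eigenvalue_in_pseudospectrum) (auto simp: multiple_eigenvalue_def)
    show "\<forall>\<^sub>F z in at l\<^sub>0. \<forall>\<epsilon>>0. cmod (z - l\<^sub>0) ^ p\<^sub>0 < \<epsilon> * \<phi> z \<longrightarrow> z \<in> pseudospectrum n m A w \<epsilon>"
      using regular
    proof eventually_elim
      case (elim z)
      show ?case
      proof (intro allI impI)
        fix \<epsilon> :: real assume \<epsilon>: "0 < \<epsilon>" "cmod (z - l\<^sub>0) ^ p\<^sub>0 < \<epsilon> * \<phi> z"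
        have "0 < cmod (z - l\<^sub>0) ^ p\<^sub>0" using elim by simp
        moreover have "cmod (z - l\<^sub>0) ^ p\<^sub>0 * 1
            < cmod (z - l\<^sub>0) ^ p\<^sub>0 * (\<epsilon> * weight m w (cmod z) * spectral_norm (?R z))"
          using \<epsilon>(2) by (simp add: \<phi>_def mult_ac)
        ultimately have "1 < \<epsilon> * weight m w (cmod z) * spectral_norm (?R z)"
          using mult_less_cancel_left_pos by blast
        then show "z \<in> pseudospectrum n m A w \<epsilon>"
          using elim assms(4,5) \<epsilon>(1) by (intro in_pseudospectrum[OF mat_poly_inverse_carrier]) auto
      qed
    qed
    show "\<forall>\<^sub>F z in at l\<^sub>0. \<forall>\<epsilon>>0. \<epsilon> * \<phi> z < cmod (z - l\<^sub>0) ^ p\<^sub>0 \<longrightarrow> z \<notin> pseudospectrum n m A w \<epsilon>"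
      using regular
    proof eventually_elim
      case (elim z)
      show ?case
      proof (intro allI impI)
        fix \<epsilon> :: real assume \<epsilon>: "0 < \<epsilon>" "\<epsilon> * \<phi> z < cmod (z - l\<^sub>0) ^ p\<^sub>0"
        have "0 < cmod (z - l\<^sub>0) ^ p\<^sub>0" using elim by simp
        moreover have "cmod (z - l\<^sub>0) ^ p\<^sub>0 * (\<epsilon> * weight m w (cmod z) * spectral_norm (?R z))
            < cmod (z - l\<^sub>0) ^ p\<^sub>0 * 1"
          using \<epsilon>(2) by (simp add: \<phi>_def mult_ac)
        ultimately have "\<epsilon> * weight m w (cmod z) * spectral_norm (?R z) < 1"
          using mult_less_cancel_left_pos by blast
        then show "z \<notin> pseudospectrum n m A w \<epsilon>"
          using elim by (intro not_in_pseudospectrum[OF mat_poly_inverse_carrier]) auto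
      qed
    qed
  qed
qed

end
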